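(* Let $\mathcal V$ be a monoidal additive category with tensor product $\otimes$ and unit $I$, and let $\lambda\in\mathcal V(I,I)$. For graphs $(A_1,E_1),\dots,(A_n,E_n)$ in $\mathcal V$ define the $n$-fold tensor product $$\otimes^{\lambda}_{1\le i\le n}(A_i,E_i)=\bigl(A_1\otimes\dots\otimes A_n,\;E_1\otimes\dots\otimes E_n\bigr)$$ with source and target morphisms $$s=\sum_{\varnothing\ne R\subseteq\langle n\rangle}\lambda^{(\#R-1)}\,\chi_R(1)\otimes\dots\otimes\chi_R(n),\qquad t=t\otimes\dots\otimes t .$$ Then this defines a monoidal structure on the category $\operatorname{Gph}\mathcal V$ (with binary tensor product the case $n=2$, having $s=\lambda\, s\otimes s+s\otimes t+t\otimes s$ and $t=t\otimes t$, and unit the graph $(I,I)$ with $s=0$ and $t=1_I$). Moreover both forgetful functors $\mathrm{ver}\colon\operatorname{Gph}\mathcal V\to\mathcal V$, $(A,E)\mapsto A$, and $\mathrm{edg}\colon\operatorname{Gph}\mathcal V\to\mathcal V$, $(A,E)\mapsto E$, are strict monoidal.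
   Context: A graph $(A,E)$ in $\mathcal V$ is a pair of parallel morphisms $s,t\colon E\to A$ in $\mathcal V$ (source and target; the same letters are used for all graphs). A morphism $(f,\phi)\colon(A,E)\to(B,F)$ in $\operatorname{Gph}\mathcal V$ consists of $f\colon A\to B$ and $\phi\colon E\to F$ with $s\phi=fs$ and $t\phi=ft$. A monoidal additive category is an additive category with a monoidal structure whose tensor product is additive in each variable; one writes as if the monoidal structure of $\mathcal V$ were strict. For $f\colon A\to B$ in $\mathcal V$, $\lambda f\colon A\to B$ denotes $\lambda\otimes f\colon I\otimes A\to I\otimes B$, and $\lambda^m$ is the $m$-fold composite of $\lambda$. $\langle n\rangle=\{1,\dots,n\}$, $\#R$ is the cardinality of $R$, and for $R\subseteq\langle n\rangle$, $\chi_R(i)$ is the source morphism $s\colon E_i\to A_i$ if $i\in R$ and the target morphism $t\colon E_i\to A_i$ if $i\notin R$.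
   Formalization: The formal statement adds that λ is central, λ⊗X = X⊗λ for every object X (automatic if V is braided). Without this the tensor product is not associative, e.g. for bimodules over k×k with λ=(1,0); the condition is also necessary. *)

theory Defs
  imports "HOL-Algebra.FiniteProduct"
begin

section \<open>Categories and functors\<close>

text \<open>A category is given by its hom-sets. Different hom-sets need not be disjoint; composition is a
  binary operation on the ambient type, constrained only on composable pairs.\<close>

record ('o, 'm) category_data =
  Obj :: "'o set"
  Hom :: "'o \<Rightarrow> 'o \<Rightarrow> 'm set"
  Comp :: "'m \<Rightarrow> 'm \<Rightarrow> 'm"  (infixr \<open>\<cdot>\<index>\<close> 65)
  Ide :: "'o \<Rightarrow> 'm"

locale category =
  fixes C :: "('o, 'm, 'z) category_data_scheme" (structure)
  assumes comp_closed: "\<lbrakk>X \<in> Obj C; Y \<in> Obj C; Z \<in> Obj C; f \<in> Hom C X Y; g \<in> Hom C Y Z\<rbrakk>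
      \<Longrightarrow> g \<cdot> f \<in> Hom C X Z"
    and ide_closed: "X \<in> Obj C \<Longrightarrow> Ide C X \<in> Hom C X X"
    and ide_left: "\<lbrakk>X \<in> Obj C; Y \<in> Obj C; f \<in> Hom C X Y\<rbrakk> \<Longrightarrow> Ide C Y \<cdot> f = f"
    and ide_right: "\<lbrakk>X \<in> Obj C; Y \<in> Obj C; f \<in> Hom C X Y\<rbrakk> \<Longrightarrow> f \<cdot> Ide C X = f"
    and comp_assoc: "\<lbrakk>W \<in> Obj C; X \<in> Obj C; Y \<in> Obj C; Z \<in> Obj C;
        f \<in> Hom C W X; g \<in> Hom C X Y; h \<in> Hom C Y Z\<rbrakk> \<Longrightarrow> (h \<cdot> g) \<cdot> f = h \<cdot> (g \<cdot> f)"

definition isomorphism :: "('o, 'm, 'z) category_data_scheme \<Rightarrow> 'o \<Rightarrow> 'o \<Rightarrow> 'm \<Rightarrow> bool" where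
  "isomorphism C X Y f \<longleftrightarrow> f \<in> Hom C X Y \<and>
     (\<exists>g \<in> Hom C Y X. g \<cdot>\<^bsub>C\<^esub> f = Ide C X \<and> f \<cdot>\<^bsub>C\<^esub> g = Ide C Y)"

definition inverse_arr :: "('o, 'm, 'z) category_data_scheme \<Rightarrow> 'o \<Rightarrow> 'o \<Rightarrow> 'm \<Rightarrow> 'm" where
  "inverse_arr C X Y f =
     (THE g. g \<in> Hom C Y X \<and> g \<cdot>\<^bsub>C\<^esub> f = Ide C X \<and> f \<cdot>\<^bsub>C\<^esub> g = Ide C Y)"

definition product_category :: "('o, 'm, 'z) category_data_scheme \<Rightarrow>
    ('p, 'n, 'y) category_data_scheme \<Rightarrow> ('o \<times> 'p, 'm \<times> 'n) category_data" where
  "product_category C D = \<lparr>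
     Obj = Obj C \<times> Obj D,
     Hom = (\<lambda>(X, X') (Y, Y'). Hom C X Y \<times> Hom D X' Y'),
     Comp = (\<lambda>(g, g') (f, f'). (g \<cdot>\<^bsub>C\<^esub> f, g' \<cdot>\<^bsub>D\<^esub> f')),
     Ide = (\<lambda>(X, X'). (Ide C X, Ide D X'))\<rparr>"

locale category_functor = C: category C + D: category D
  for C :: "('o, 'm, 'z) category_data_scheme"
    and D :: "('p, 'n, 'y) category_data_scheme"
    and Fo :: "'o \<Rightarrow> 'p" and Fm :: "'m \<Rightarrow> 'n" +
  assumes map_obj: "X \<in> Obj C \<Longrightarrow> Fo X \<in> Obj D"
    and map_arr: "\<lbrakk>X \<in> Obj C; Y \<in> Obj C; f \<in> Hom C X Y\<rbrakk> \<Longrightarrow> Fm f \<in> Hom D (Fo X) (Fo Y)"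
    and map_ide: "X \<in> Obj C \<Longrightarrow> Fm (Ide C X) = Ide D (Fo X)"
    and map_comp: "\<lbrakk>X \<in> Obj C; Y \<in> Obj C; Z \<in> Obj C; f \<in> Hom C X Y; g \<in> Hom C Y Z\<rbrakk>
      \<Longrightarrow> Fm (g \<cdot>\<^bsub>C\<^esub> f) = Fm g \<cdot>\<^bsub>D\<^esub> Fm f"


section \<open>Monoidal categories\<close>

record ('o, 'm) monoidal_data = "('o, 'm) category_data" +
  TensorObj :: "'o \<Rightarrow> 'o \<Rightarrow> 'o"  (infixr \<open>\<boxtimes>\<index>\<close> 70)
  TensorArr :: "'m \<Rightarrow> 'm \<Rightarrow> 'm"  (infixr \<open>\<odot>\<index>\<close> 70)
  Unit :: 'o
  Assoc :: "'o \<Rightarrow> 'o \<Rightarrow> 'o \<Rightarrow> 'm"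
  LUnit :: "'o \<Rightarrow> 'm"
  RUnit :: "'o \<Rightarrow> 'm"

locale monoidal_category = category V
  for V :: "('o, 'm, 'z) monoidal_data_scheme" (structure) +
  assumes tensor_functor: "category_functor (product_category V V) V
      (\<lambda>(X, Y). X \<boxtimes> Y) (\<lambda>(f, g). f \<odot> g)"
    and unit_obj: "Unit V \<in> Obj V"
    and assoc_iso: "\<lbrakk>X \<in> Obj V; Y \<in> Obj V; Z \<in> Obj V\<rbrakk>
      \<Longrightarrow> isomorphism V ((X \<boxtimes> Y) \<boxtimes> Z) (X \<boxtimes> (Y \<boxtimes> Z)) (Assoc V X Y Z)"
    and assoc_natural: "\<lbrakk>X \<in> Obj V; Y \<in> Obj V; Z \<in> Obj V; X' \<in> Obj V; Y' \<in> Obj V; Z' \<in> Obj V;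
        f \<in> Hom V X X'; g \<in> Hom V Y Y'; h \<in> Hom V Z Z'\<rbrakk>
      \<Longrightarrow> Assoc V X' Y' Z' \<cdot> ((f \<odot> g) \<odot> h) = (f \<odot> (g \<odot> h)) \<cdot> Assoc V X Y Z"
    and lunit_iso: "X \<in> Obj V \<Longrightarrow> isomorphism V (Unit V \<boxtimes> X) X (LUnit V X)"
    and lunit_natural: "\<lbrakk>X \<in> Obj V; Y \<in> Obj V; f \<in> Hom V X Y\<rbrakk>
      \<Longrightarrow> LUnit V Y \<cdot> (Ide V (Unit V) \<odot> f) = f \<cdot> LUnit V X"
    and runit_iso: "X \<in> Obj V \<Longrightarrow> isomorphism V (X \<boxtimes> Unit V) X (RUnit V X)"
    and runit_natural: "\<lbrakk>X \<in> Obj V; Y \<in> Obj V; f \<in> Hom V X Y\<rbrakk>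
      \<Longrightarrow> RUnit V Y \<cdot> (f \<odot> Ide V (Unit V)) = f \<cdot> RUnit V X"
    and pentagon: "\<lbrakk>W \<in> Obj V; X \<in> Obj V; Y \<in> Obj V; Z \<in> Obj V\<rbrakk>
      \<Longrightarrow> (Ide V W \<odot> Assoc V X Y Z) \<cdot> Assoc V W (X \<boxtimes> Y) Z \<cdot> (Assoc V W X Y \<odot> Ide V Z)
        = Assoc V W X (Y \<boxtimes> Z) \<cdot> Assoc V (W \<boxtimes> X) Y Z"
    and triangle: "\<lbrakk>X \<in> Obj V; Y \<in> Obj V\<rbrakk>
      \<Longrightarrow> (Ide V X \<odot> LUnit V Y) \<cdot> Assoc V X (Unit V) Y = RUnit V X \<odot> Ide V Y"

locale strict_monoidal_functor =
  category_functor V W Fo Fm + V: monoidal_category V + W: monoidal_category W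
  for V :: "('o, 'm, 'z) monoidal_data_scheme"
    and W :: "('p, 'n, 'y) monoidal_data_scheme"
    and Fo :: "'o \<Rightarrow> 'p" and Fm :: "'m \<Rightarrow> 'n" +
  assumes map_tensor_obj: "\<lbrakk>X \<in> Obj V; Y \<in> Obj V\<rbrakk> \<Longrightarrow> Fo (X \<boxtimes>\<^bsub>V\<^esub> Y) = Fo X \<boxtimes>\<^bsub>W\<^esub> Fo Y"
    and map_tensor_arr: "\<lbrakk>X \<in> Obj V; Y \<in> Obj V; X' \<in> Obj V; Y' \<in> Obj V;
        f \<in> Hom V X X'; g \<in> Hom V Y Y'\<rbrakk> \<Longrightarrow> Fm (f \<odot>\<^bsub>V\<^esub> g) = Fm f \<odot>\<^bsub>W\<^esub> Fm g"
    and map_unit: "Fo (Unit V) = Unit W"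
    and map_assoc: "\<lbrakk>X \<in> Obj V; Y \<in> Obj V; Z \<in> Obj V\<rbrakk>
      \<Longrightarrow> Fm (Assoc V X Y Z) = Assoc W (Fo X) (Fo Y) (Fo Z)"
    and map_lunit: "X \<in> Obj V \<Longrightarrow> Fm (LUnit V X) = LUnit W (Fo X)"
    and map_runit: "X \<in> Obj V \<Longrightarrow> Fm (RUnit V X) = RUnit W (Fo X)"


section \<open>Additive and monoidal additive categories\<close>

text \<open>\<open>H X Y\<close> is the abelian group of morphisms from \<open>X\<close> to \<open>Y\<close>. HOL-Algebra writes groups
  multiplicatively, so its \<open>mult\<close>, \<open>one\<close> and \<open>finprod\<close> are here the sum of two morphisms, the zero
  morphism and the sum of a finite family.\<close>

abbreviation add_arr :: "('o \<Rightarrow> 'o \<Rightarrow> 'm monoid) \<Rightarrow> 'o \<Rightarrow> 'o \<Rightarrow> 'm \<Rightarrow> 'm \<Rightarrow> 'm" where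
  "add_arr H X Y \<equiv> mult (H X Y)"

abbreviation zero_arr :: "('o \<Rightarrow> 'o \<Rightarrow> 'm monoid) \<Rightarrow> 'o \<Rightarrow> 'o \<Rightarrow> 'm" where
  "zero_arr H X Y \<equiv> one (H X Y)"

abbreviation sum_arr :: "('o \<Rightarrow> 'o \<Rightarrow> 'm monoid) \<Rightarrow> 'o \<Rightarrow> 'o \<Rightarrow> ('i \<Rightarrow> 'm) \<Rightarrow> 'i set \<Rightarrow> 'm" where
  "sum_arr H X Y \<equiv> finprod (H X Y)"

definition zero_object :: "('o, 'm, 'z) category_data_scheme \<Rightarrow> 'o \<Rightarrow> bool" where
  "zero_object C Z \<longleftrightarrow> Z \<in> Obj C \<and>
     (\<forall>X \<in> Obj C. (\<exists>!f. f \<in> Hom C X Z) \<and> (\<exists>!f. f \<in> Hom C Z X))"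

definition biproduct :: "('o, 'm, 'z) category_data_scheme \<Rightarrow> ('o \<Rightarrow> 'o \<Rightarrow> 'm monoid) \<Rightarrow>
    'o \<Rightarrow> 'o \<Rightarrow> 'o \<Rightarrow> 'm \<Rightarrow> 'm \<Rightarrow> 'm \<Rightarrow> 'm \<Rightarrow> bool" where
  "biproduct C H X Y P i j p q \<longleftrightarrow> P \<in> Obj C \<and>
     i \<in> Hom C X P \<and> j \<in> Hom C Y P \<and> p \<in> Hom C P X \<and> q \<in> Hom C P Y \<and>
     p \<cdot>\<^bsub>C\<^esub> i = Ide C X \<and> q \<cdot>\<^bsub>C\<^esub> j = Ide C Y \<and>
     p \<cdot>\<^bsub>C\<^esub> j = zero_arr H Y X \<and> q \<cdot>\<^bsub>C\<^esub> i = zero_arr H X Y \<and>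
     add_arr H P P (i \<cdot>\<^bsub>C\<^esub> p) (j \<cdot>\<^bsub>C\<^esub> q) = Ide C P"

locale additive_category = category C
  for C :: "('o, 'm, 'z) category_data_scheme" (structure)
    and H :: "'o \<Rightarrow> 'o \<Rightarrow> 'm monoid" +
  assumes hom_carrier: "\<lbrakk>X \<in> Obj C; Y \<in> Obj C\<rbrakk> \<Longrightarrow> carrier (H X Y) = Hom C X Y"
    and hom_group: "\<lbrakk>X \<in> Obj C; Y \<in> Obj C\<rbrakk> \<Longrightarrow> comm_group (H X Y)"
    and comp_additive_right: "\<lbrakk>X \<in> Obj C; Y \<in> Obj C; Z \<in> Obj C; g \<in> Hom C Y Z\<rbrakk>
      \<Longrightarrow> (\<lambda>f. g \<cdot> f) \<in> hom (H X Y) (H X Z)"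
    and comp_additive_left: "\<lbrakk>X \<in> Obj C; Y \<in> Obj C; Z \<in> Obj C; f \<in> Hom C X Y\<rbrakk>
      \<Longrightarrow> (\<lambda>g. g \<cdot> f) \<in> hom (H Y Z) (H X Z)"
    and ex_zero_object: "\<exists>Z. zero_object C Z"
    and ex_biproduct: "\<lbrakk>X \<in> Obj C; Y \<in> Obj C\<rbrakk> \<Longrightarrow> \<exists>P i j p q. biproduct C H X Y P i j p q"

locale monoidal_additive_category = monoidal_category V + additive_category V H
  for V :: "('o, 'm, 'z) monoidal_data_scheme" (structure)
    and H :: "'o \<Rightarrow> 'o \<Rightarrow> 'm monoid" +
  assumes tensor_additive_left:
      "\<lbrakk>X \<in> Obj V; Y \<in> Obj V; X' \<in> Obj V; Y' \<in> Obj V; g \<in> Hom V Y Y'\<rbrakk>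
      \<Longrightarrow> (\<lambda>f. f \<odot> g) \<in> hom (H X X') (H (X \<boxtimes> Y) (X' \<boxtimes> Y'))"
    and tensor_additive_right:
      "\<lbrakk>X \<in> Obj V; Y \<in> Obj V; X' \<in> Obj V; Y' \<in> Obj V; f \<in> Hom V X X'\<rbrakk>
      \<Longrightarrow> (\<lambda>g. f \<odot> g) \<in> hom (H Y Y') (H (X \<boxtimes> Y) (X' \<boxtimes> Y'))"


section \<open>Scalars\<close>

definition scale :: "('o, 'm, 'z) monoidal_data_scheme \<Rightarrow> 'm \<Rightarrow> 'o \<Rightarrow> 'o \<Rightarrow> 'm \<Rightarrow> 'm" where
  "scale V l X Y f =
     LUnit V Y \<cdot>\<^bsub>V\<^esub> (l \<odot>\<^bsub>V\<^esub> f) \<cdot>\<^bsub>V\<^esub> inverse_arr V (Unit V \<boxtimes>\<^bsub>V\<^esub> X) X (LUnit V X)"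

definition scale_right :: "('o, 'm, 'z) monoidal_data_scheme \<Rightarrow> 'm \<Rightarrow> 'o \<Rightarrow> 'o \<Rightarrow> 'm \<Rightarrow> 'm" where
  "scale_right V l X Y f =
     RUnit V Y \<cdot>\<^bsub>V\<^esub> (f \<odot>\<^bsub>V\<^esub> l) \<cdot>\<^bsub>V\<^esub> inverse_arr V (X \<boxtimes>\<^bsub>V\<^esub> Unit V) X (RUnit V X)"

text \<open>In strict notation: \<open>l \<otimes> X = X \<otimes> l\<close> for every object \<open>X\<close>. This holds in every braided (in
  particular symmetric) monoidal category, but not in general: on a bimodule over a commutative
  ring, multiplying by a ring element on the left and on the right are different. For graphs
  \<open>G = (X, X)\<close> with \<open>s = 0\<close>, \<open>t = 1\<close> and \<open>K = (I, I)\<close> with \<open>s = 1\<close>, \<open>t = 0\<close>, the sources of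
  \<open>(G \<otimes> K) \<otimes> K\<close> and \<open>G \<otimes> (K \<otimes> K)\<close> are \<open>l \<otimes> X\<close> and \<open>X \<otimes> l\<close>, so the condition is
  necessary for the \<open>l\<close>-tensor product of graphs to be associative.\<close>

definition central_scalar :: "('o, 'm, 'z) monoidal_data_scheme \<Rightarrow> 'm \<Rightarrow> bool" where
  "central_scalar V l \<longleftrightarrow>
     (\<forall>X \<in> Obj V. scale V l X X (Ide V X) = scale_right V l X X (Ide V X))"

definition scalar_power :: "('o, 'm, 'z) monoidal_data_scheme \<Rightarrow> 'm \<Rightarrow> nat \<Rightarrow> 'm" where
  "scalar_power V l m = ((\<lambda>f. l \<cdot>\<^bsub>V\<^esub> f) ^^ m) (Ide V (Unit V))"


section \<open>Bracketed \<open>n\<close>-fold tensor products\<close>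

text \<open>Since \<open>V\<close> is not strict, \<open>A\<^sub>1 \<otimes> \<dots> \<otimes> A\<^sub>n\<close> depends on a bracketing. Bracketings are Mac Lane's
  words: \<open>Empty\<close> evaluates to the unit object, and the slots of a word of length \<open>n\<close> are filled,
  from left to right, with the entries \<open>1, \<dots>, n\<close> of a family.\<close>

datatype word = Empty | Slot | Join word word

primrec len :: "word \<Rightarrow> nat" where
  "len Empty = 0"
| "len Slot = 1"
| "len (Join u v) = len u + len v"

primrec word_obj :: "('o, 'm, 'z) monoidal_data_scheme \<Rightarrow> word \<Rightarrow> (nat \<Rightarrow> 'o) \<Rightarrow> 'o" where
  "word_obj V Empty A = Unit V"
| "word_obj V Slot A = A 1"
| "word_obj V (Join u v) A = word_obj V u A \<boxtimes>\<^bsub>V\<^esub> word_obj V v (\<lambda>i. A (len u + i))"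

primrec word_arr :: "('o, 'm, 'z) monoidal_data_scheme \<Rightarrow> word \<Rightarrow> (nat \<Rightarrow> 'm) \<Rightarrow> 'm" where
  "word_arr V Empty f = Ide V (Unit V)"
| "word_arr V Slot f = f 1"
| "word_arr V (Join u v) f = word_arr V u f \<odot>\<^bsub>V\<^esub> word_arr V v (\<lambda>i. f (len u + i))"


section \<open>Graphs\<close>

record ('o, 'm) graph =
  ver :: 'o
  edg :: 'o
  src :: 'm
  tgt :: 'm

definition Gph :: "('o, 'm, 'z) category_data_scheme \<Rightarrow> (('o, 'm) graph, 'm \<times> 'm) category_data" where
  "Gph V = \<lparr>
     Obj = {G. ver G \<in> Obj V \<and> edg G \<in> Obj V \<and>
               src G \<in> Hom V (edg G) (ver G) \<and> tgt G \<in> Hom V (edg G) (ver G)},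
     Hom = (\<lambda>G K. {(f, p). f \<in> Hom V (ver G) (ver K) \<and> p \<in> Hom V (edg G) (edg K) \<and>
               src K \<cdot>\<^bsub>V\<^esub> p = f \<cdot>\<^bsub>V\<^esub> src G \<and> tgt K \<cdot>\<^bsub>V\<^esub> p = f \<cdot>\<^bsub>V\<^esub> tgt G}),
     Comp = (\<lambda>(g, q) (f, p). (g \<cdot>\<^bsub>V\<^esub> f, q \<cdot>\<^bsub>V\<^esub> p)),
     Ide = (\<lambda>G. (Ide V (ver G), Ide V (edg G)))\<rparr>"

definition chi :: "(nat \<Rightarrow> ('o, 'm) graph) \<Rightarrow> nat set \<Rightarrow> nat \<Rightarrow> 'm" where
  "chi G R i = (if i \<in> R then src (G i) else tgt (G i))"

definition graph_tensor :: "('o, 'm, 'z) monoidal_data_scheme \<Rightarrow> ('o \<Rightarrow> 'o \<Rightarrow> 'm monoid) \<Rightarrow> 'm \<Rightarrow>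
    word \<Rightarrow> (nat \<Rightarrow> ('o, 'm) graph) \<Rightarrow> ('o, 'm) graph" where
  "graph_tensor V H l w G =
     (let A = word_obj V w (\<lambda>i. ver (G i)); E = word_obj V w (\<lambda>i. edg (G i)) in
      \<lparr>ver = A,
       edg = E,
       src = sum_arr H E A
               (\<lambda>R. scale V (scalar_power V l (card R - 1)) E A (word_arr V w (chi G R)))
               {R. R \<noteq> {} \<and> R \<subseteq> {1..len w}},
       tgt = word_arr V w (\<lambda>i. tgt (G i))\<rparr>)"

text \<open>The structure isomorphisms below are the only ones for which \<open>ver\<close> and \<open>edg\<close> can be strict
  monoidal.\<close>

definition Gph_monoidal :: "('o, 'm, 'z) monoidal_data_scheme \<Rightarrow> ('o \<Rightarrow> 'o \<Rightarrow> 'm monoid) \<Rightarrow> 'm \<Rightarrow>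
    (('o, 'm) graph, 'm \<times> 'm) monoidal_data" where
  "Gph_monoidal V H l = category_data.extend (Gph V) (monoidal_data.fields
     (\<lambda>G K. graph_tensor V H l (Join Slot Slot) (\<lambda>i. if i = 1 then G else K))
     (\<lambda>(f, p) (g, q). (f \<odot>\<^bsub>V\<^esub> g, p \<odot>\<^bsub>V\<^esub> q))
     (graph_tensor V H l Empty (\<lambda>i. undefined))
     (\<lambda>G K L. (Assoc V (ver G) (ver K) (ver L), Assoc V (edg G) (edg K) (edg L)))
     (\<lambda>G. (LUnit V (ver G), LUnit V (edg G)))
     (\<lambda>G. (RUnit V (ver G), RUnit V (edg G))))"

end

theory Submission
  imports Defs
begin

text \<open>By induction on the bracketing, the sum over the nonempty subsets of \<open>{1..m + n}\<close> splits
  according to whether a subset meets both, only the first, or only the second block. Since \<open>l\<close>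
  slides freely across tensor factors (Kelly's coherence \<open>\<lambda> \<circ> \<alpha> = \<lambda> \<otimes> 1\<close> on the left, the triangle
  axiom and centrality on the right), the three parts are \<open>l (s \<otimes> s)\<close>, \<open>s \<otimes> t\<close> and \<open>t \<otimes> s\<close>.
  Hence iterating the binary tensor product along any bracketing gives the closed formula. As the
  latter sees the bracketing only through the tensor products of the summands, naturality of the
  structure isomorphisms of \<open>V\<close> makes them graph morphisms, and the axioms hold componentwise.\<close>

section \<open>Coherence of the unit\<close>

text \<open>The closed formula comes from the combination t + l s. Over all subsets R, the empty one
  included, the sum of l^(#R) times the product of the chi_R(i) expands the tensor product of the
  morphisms t + l s; so l times the source of a product is that tensor product minus t \<otimes> ...
  \<otimes> t, and #R - 1 is the exponent left after dividing by l. This explains associativity but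
  does not prove it, since l need not be cancellable. The sums themselves are therefore compared:
  nonempty blocks of sizes a and b bring (a - 1) + (b - 1) factors of l, and the l in front of s
  \<otimes> s supplies the missing one. The other obstacle is that V is not strict, so that
  multiplying by l involves a left unitor and its inverse. A scalar standing between two factors may
  be absorbed by either of them; carrying it from the right of an object to its left is precisely
  what centrality allows.\<close>

context category
begin

text \<open>The axioms ask for membership of every object and every arrow separately. Bundling the
  three facts lets typing conditions be discharged by introduction rules.\<close>

definition in_hom :: "'m \<Rightarrow> 'o \<Rightarrow> 'o \<Rightarrow> bool" where
  "in_hom f X Y \<longleftrightarrow> X \<in> Obj C \<and> Y \<in> Obj C \<and> f \<in> Hom C X Y"

lemma in_homD:
  assumes "in_hom f X Y"
  shows "X \<in> Obj C" "Y \<in> Obj C" "f \<in> Hom C X Y"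
  using assms by (auto simp: in_hom_def)

lemma ide_in_hom [intro]: "X \<in> Obj C \<Longrightarrow> in_hom (Ide C X) X X"
  by (simp add: in_hom_def ide_closed)

lemma comp_in_hom [intro]: "\<lbrakk>in_hom g Y Z; in_hom f X Y\<rbrakk> \<Longrightarrow> in_hom (g \<cdot> f) X Z"
  unfolding in_hom_def using comp_closed by blast

lemma comp_ide_left: "in_hom f X Y \<Longrightarrow> Ide C Y \<cdot> f = f"
  unfolding in_hom_def using ide_left by blast

lemma comp_ide_right: "in_hom f X Y \<Longrightarrow> f \<cdot> Ide C X = f"
  unfolding in_hom_def using ide_right by blast

lemma in_hom_assoc:
  "\<lbrakk>in_hom f W X; in_hom g X Y; in_hom h Y Z\<rbrakk> \<Longrightarrow> (h \<cdot> g) \<cdot> f = h \<cdot> g \<cdot> f"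
  unfolding in_hom_def using comp_assoc by blast

lemma isomorphism_in_hom:
  "\<lbrakk>isomorphism C X Y f; X \<in> Obj C; Y \<in> Obj C\<rbrakk> \<Longrightarrow> in_hom f X Y"
  by (simp add: isomorphism_def in_hom_def)

text \<open>Right cancellation is the device behind most equations below: both sides are precomposed
  with a unitor or an associator, which brings them into the range of the coherence axioms.\<close>

lemma isomorphism_epi:
  assumes iso: "isomorphism C X Y e" and e: "in_hom e X Y"
    and g: "in_hom g Y Z" "in_hom h Y Z" and eq: "g \<cdot> e = h \<cdot> e"
  shows "g = h"
proof -
  obtain d where d: "in_hom d Y X" "e \<cdot> d = Ide C Y"
    using iso e unfolding isomorphism_def in_hom_def by auto
  have "g = (g \<cdot> e) \<cdot> d"
    using d in_hom_assoc[OF d(1) e g(1)] comp_ide_right[OF g(1)] by simp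
  also have "\<dots> = h"
    using d in_hom_assoc[OF d(1) e g(2)] comp_ide_right[OF g(2)] eq by simp
  finally show ?thesis .
qed

text \<open>The inverse is given by a definite description, so its uniqueness has to be supplied; it
  follows from right cancellation of \<open>e\<close>.\<close>

lemma isomorphism_inverse_arr:
  assumes iso: "isomorphism C X Y e" and ob: "X \<in> Obj C" "Y \<in> Obj C"
  shows "in_hom (inverse_arr C X Y e) Y X" "inverse_arr C X Y e \<cdot> e = Ide C X"
    "e \<cdot> inverse_arr C X Y e = Ide C Y"
proof -
  obtain d where d: "d \<in> Hom C Y X" "d \<cdot> e = Ide C X" "e \<cdot> d = Ide C Y"
    using iso unfolding isomorphism_def by auto
  have e: "e \<in> Hom C X Y" using iso by (simp add: isomorphism_def)
  have "\<exists>!g. g \<in> Hom C Y X \<and> g \<cdot> e = Ide C X \<and> e \<cdot> g = Ide C Y"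
  proof (intro ex1I[of _ d] conjI d)
    fix g assume g: "g \<in> Hom C Y X \<and> g \<cdot> e = Ide C X \<and> e \<cdot> g = Ide C Y"
    show "g = d"
      using isomorphism_epi[OF iso, of g X d] g d e ob by (simp add: in_hom_def)
  qed
  then have "inverse_arr C X Y e \<in> Hom C Y X \<and> inverse_arr C X Y e \<cdot> e = Ide C X
      \<and> e \<cdot> inverse_arr C X Y e = Ide C Y"
    unfolding inverse_arr_def by (rule theI')
  then show "in_hom (inverse_arr C X Y e) Y X" "inverse_arr C X Y e \<cdot> e = Ide C X"
    "e \<cdot> inverse_arr C X Y e = Ide C Y"
    using ob by (auto simp: in_hom_def)
qed

end

section \<open>Functoriality of the tensor product and Kelly's coherence law for the unit\<close>

context monoidal_category
begin

lemma tensor_obj [intro]: "\<lbrakk>X \<in> Obj V; Y \<in> Obj V\<rbrakk> \<Longrightarrow> X \<boxtimes> Y \<in> Obj V"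
  using category_functor.map_obj[OF tensor_functor, of "(X, Y)"]
  by (simp add: product_category_def)

lemma tensor_in_hom [intro]:
  "\<lbrakk>in_hom f X X'; in_hom g Y Y'\<rbrakk> \<Longrightarrow> in_hom (f \<odot> g) (X \<boxtimes> Y) (X' \<boxtimes> Y')"
  using category_functor.map_arr[OF tensor_functor, of "(X, Y)" "(X', Y')" "(f, g)"]
  by (auto simp: product_category_def in_hom_def)

lemma tensor_ide: "\<lbrakk>X \<in> Obj V; Y \<in> Obj V\<rbrakk> \<Longrightarrow> Ide V X \<odot> Ide V Y = Ide V (X \<boxtimes> Y)"
  using category_functor.map_ide[OF tensor_functor, of "(X, Y)"]
  by (simp add: product_category_def)

text \<open>In this notation \<open>\<odot>\<close> binds more tightly than \<open>\<cdot>\<close>,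
  so the left-hand side is a composite of two tensor products.\<close>

lemma interchange:
  "\<lbrakk>in_hom f X Y; in_hom g Y Z; in_hom f' X' Y'; in_hom g' Y' Z'\<rbrakk>
    \<Longrightarrow> g \<odot> g' \<cdot> f \<odot> f' = (g \<cdot> f) \<odot> (g' \<cdot> f')"
  using category_functor.map_comp[OF tensor_functor,
      of "(X, X')" "(Y, Y')" "(Z, Z')" "(f, f')" "(g, g')"]
  by (simp add: product_category_def in_hom_def)

lemma assoc_in_hom [intro]:
  "\<lbrakk>X \<in> Obj V; Y \<in> Obj V; Z \<in> Obj V\<rbrakk>
    \<Longrightarrow> in_hom (Assoc V X Y Z) ((X \<boxtimes> Y) \<boxtimes> Z) (X \<boxtimes> Y \<boxtimes> Z)"
  using isomorphism_in_hom[OF assoc_iso] by blast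

lemma lunit_in_hom [intro]: "X \<in> Obj V \<Longrightarrow> in_hom (LUnit V X) (Unit V \<boxtimes> X) X"
  using isomorphism_in_hom[OF lunit_iso] unit_obj by blast

lemma runit_in_hom [intro]: "X \<in> Obj V \<Longrightarrow> in_hom (RUnit V X) (X \<boxtimes> Unit V) X"
  using isomorphism_in_hom[OF runit_iso] unit_obj by blast

lemma tensor_isomorphism:
  assumes "isomorphism V X X' f" "isomorphism V Y Y' g"
    and ob: "X \<in> Obj V" "X' \<in> Obj V" "Y \<in> Obj V" "Y' \<in> Obj V"
  shows "isomorphism V (X \<boxtimes> Y) (X' \<boxtimes> Y') (f \<odot> g)"
proof -
  obtain f' g' where inv: "in_hom f' X' X" "f' \<cdot> f = Ide V X" "f \<cdot> f' = Ide V X'"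
      "in_hom g' Y' Y" "g' \<cdot> g = Ide V Y" "g \<cdot> g' = Ide V Y'"
    using assms unfolding isomorphism_def in_hom_def by blast
  have fg: "in_hom f X X'" "in_hom g Y Y'"
    using assms isomorphism_in_hom by blast+
  have "f' \<odot> g' \<cdot> f \<odot> g = Ide V (X \<boxtimes> Y)" "f \<odot> g \<cdot> f' \<odot> g' = Ide V (X' \<boxtimes> Y')"
    using interchange[OF fg(1) inv(1) fg(2) inv(4)] interchange[OF inv(1) fg(1) inv(4) fg(2)]
      inv ob by (simp_all add: tensor_ide)
  then show ?thesis
    unfolding isomorphism_def
    using tensor_in_hom[OF fg] tensor_in_hom[OF inv(1,4)] by (auto simp: in_hom_def)
qed

lemma ide_isomorphism: "X \<in> Obj V \<Longrightarrow> isomorphism V X X (Ide V X)"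
  unfolding isomorphism_def using ide_closed ide_left by blast

text \<open>Tensoring with the unit on the left is naturally isomorphic to the identity functor,
  hence faithful.\<close>

lemma lunit_faithful:
  assumes f: "in_hom f X Y" and g: "in_hom g X Y"
    and eq: "Ide V (Unit V) \<odot> f = Ide V (Unit V) \<odot> g"
  shows "f = g"
proof (rule isomorphism_epi[OF lunit_iso lunit_in_hom f g])
  show "f \<cdot> LUnit V X = g \<cdot> LUnit V X"
    using lunit_natural[of X Y f] lunit_natural[of X Y g] f g eq by (simp add: in_hom_def)
qed (use in_homD[OF f] in auto)

text \<open>This law is a consequence of the pentagon and the triangle. The axioms only speak of a
  unit in the middle, so another unit is tensored on from the left, which is harmless by
  faithfulness; the pentagon for I, I, X, Y then applies.\<close>

lemma lunit_tensor:
  assumes X: "X \<in> Obj V" and Y: "Y \<in> Obj V"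
  shows "LUnit V (X \<boxtimes> Y) \<cdot> Assoc V (Unit V) X Y = LUnit V X \<odot> Ide V Y"
proof (rule lunit_faithful)
  let ?I = "Unit V" and ?i = "Ide V (Unit V)"
  note ob [intro] = X Y unit_obj
  show th: "in_hom (LUnit V (X \<boxtimes> Y) \<cdot> Assoc V (Unit V) X Y) ((?I \<boxtimes> X) \<boxtimes> Y) (X \<boxtimes> Y)"
    "in_hom (LUnit V X \<odot> Ide V Y) ((?I \<boxtimes> X) \<boxtimes> Y) (X \<boxtimes> Y)"
    by blast+
  \<comment> \<open>These are the first two arrows of the three-arrow side of that pentagon. Both
    are isomorphisms, so they can be cancelled at the end.\<close>
  let ?a = "Assoc V ?I (?I \<boxtimes> X) Y" and ?b = "Assoc V ?I ?I X \<odot> Ide V Y"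
  have a: "in_hom ?a ((?I \<boxtimes> (?I \<boxtimes> X)) \<boxtimes> Y) (?I \<boxtimes> ((?I \<boxtimes> X) \<boxtimes> Y))" by blast
  have b: "in_hom ?b (((?I \<boxtimes> ?I) \<boxtimes> X) \<boxtimes> Y) ((?I \<boxtimes> (?I \<boxtimes> X)) \<boxtimes> Y)" by blast
  have ib: "isomorphism V (((?I \<boxtimes> ?I) \<boxtimes> X) \<boxtimes> Y) ((?I \<boxtimes> (?I \<boxtimes> X)) \<boxtimes> Y) ?b"
    by (rule tensor_isomorphism) (use assoc_iso ide_isomorphism ob in blast)+
  have ia: "isomorphism V ((?I \<boxtimes> (?I \<boxtimes> X)) \<boxtimes> Y) (?I \<boxtimes> ((?I \<boxtimes> X) \<boxtimes> Y)) ?a"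
    using assoc_iso ob by blast
  let ?l = "?i \<odot> (LUnit V (X \<boxtimes> Y) \<cdot> Assoc V (Unit V) X Y)" and ?r = "?i \<odot> (LUnit V X \<odot> Ide V Y)"
  have l: "in_hom ?l (?I \<boxtimes> ((?I \<boxtimes> X) \<boxtimes> Y)) (?I \<boxtimes> X \<boxtimes> Y)" using th ob by blast
  have r: "in_hom ?r (?I \<boxtimes> ((?I \<boxtimes> X) \<boxtimes> Y)) (?I \<boxtimes> X \<boxtimes> Y)" using th ob by blast
  have i: "in_hom ?i ?I ?I" by blast
  have lXY: "in_hom (LUnit V (X \<boxtimes> Y)) (?I \<boxtimes> (X \<boxtimes> Y)) (X \<boxtimes> Y)" by blast
  have aX: "in_hom (Assoc V ?I X Y) ((?I \<boxtimes> X) \<boxtimes> Y) (?I \<boxtimes> X \<boxtimes> Y)" by blast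
  have aII: "in_hom (Assoc V (?I \<boxtimes> ?I) X Y) (((?I \<boxtimes> ?I) \<boxtimes> X) \<boxtimes> Y) ((?I \<boxtimes> ?I) \<boxtimes> (X \<boxtimes> Y))" by blast
  have aIXY: "in_hom (Assoc V ?I ?I (X \<boxtimes> Y)) ((?I \<boxtimes> ?I) \<boxtimes> (X \<boxtimes> Y)) (?I \<boxtimes> (?I \<boxtimes> (X \<boxtimes> Y)))" by blast
  have il: "in_hom (?i \<odot> LUnit V (X \<boxtimes> Y)) (?I \<boxtimes> (?I \<boxtimes> X \<boxtimes> Y)) (?I \<boxtimes> (X \<boxtimes> Y))" by blast
  have iX: "in_hom (?i \<odot> Assoc V ?I X Y) (?I \<boxtimes> ((?I \<boxtimes> X) \<boxtimes> Y)) (?I \<boxtimes> (?I \<boxtimes> X \<boxtimes> Y))" by blast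
  have ilX: "in_hom (?i \<odot> LUnit V X) (?I \<boxtimes> (?I \<boxtimes> X)) (?I \<boxtimes> X)" by blast
  have ilXY: "in_hom ((?i \<odot> LUnit V X) \<odot> Ide V Y) ((?I \<boxtimes> (?I \<boxtimes> X)) \<boxtimes> Y) ((?I \<boxtimes> X) \<boxtimes> Y)" by blast
  have aIIX: "in_hom (Assoc V ?I ?I X) ((?I \<boxtimes> ?I) \<boxtimes> X) (?I \<boxtimes> (?I \<boxtimes> X))" by blast
  have iY: "in_hom (Ide V Y) Y Y" by blast
  have "?l \<cdot> ?a \<cdot> ?b
      = (?i \<odot> LUnit V (X \<boxtimes> Y)) \<cdot> (?i \<odot> Assoc V ?I X Y) \<cdot> ?a \<cdot> ?b"
    using interchange[OF i i aX lXY] comp_ide_left[OF i] in_hom_assoc[OF comp_in_hom[OF a b] iX il]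
    by simp
  also have "\<dots> = (?i \<odot> LUnit V (X \<boxtimes> Y)) \<cdot> Assoc V ?I ?I (X \<boxtimes> Y) \<cdot> Assoc V (?I \<boxtimes> ?I) X Y"
    using pentagon[of ?I ?I X Y] ob by simp
  \<comment> \<open>The triangle turns the left unitor of X \<otimes> Y into
    \<open>RUnit V ?I\<close>. After naturality of the associator has moved this past the
    bracketing, the triangle is read backwards to produce the left unitor of X.\<close>
  also have "\<dots> = (RUnit V ?I \<odot> Ide V (X \<boxtimes> Y)) \<cdot> Assoc V (?I \<boxtimes> ?I) X Y"
    using in_hom_assoc[OF aII aIXY il] triangle[of ?I "X \<boxtimes> Y"] ob tensor_obj by auto
  also have "\<dots> = Assoc V ?I X Y \<cdot> ((RUnit V ?I \<odot> Ide V X) \<odot> Ide V Y)"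
    using assoc_natural[of "?I \<boxtimes> ?I" X Y ?I X Y "RUnit V ?I" "Ide V X" "Ide V Y"] ob tensor_obj
      runit_in_hom[of ?I] ide_in_hom by (simp add: in_hom_def tensor_ide)
  also have "RUnit V ?I \<odot> Ide V X = (?i \<odot> LUnit V X) \<cdot> Assoc V ?I ?I X"
    using triangle[of ?I X] ob by simp
  also have "\<dots> \<odot> Ide V Y = ((?i \<odot> LUnit V X) \<odot> Ide V Y) \<cdot> ?b"
    using interchange[OF aIIX ilX iY iY] comp_ide_left[OF iY] by simp
  also have "Assoc V ?I X Y \<cdot> \<dots> = (Assoc V ?I X Y \<cdot> ((?i \<odot> LUnit V X) \<odot> Ide V Y)) \<cdot> ?b"
    by (rule in_hom_assoc[OF b ilXY aX, symmetric])
  also have "Assoc V ?I X Y \<cdot> ((?i \<odot> LUnit V X) \<odot> Ide V Y) = ?r \<cdot> ?a"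
    using assoc_natural[of ?I "?I \<boxtimes> X" Y ?I X Y ?i "LUnit V X" "Ide V Y"] ob tensor_obj
      lunit_in_hom[of X] ide_in_hom by (simp add: in_hom_def)
  finally have "(?l \<cdot> ?a) \<cdot> ?b = (?r \<cdot> ?a) \<cdot> ?b"
    using in_hom_assoc[OF b a l] by simp
  then have "?l \<cdot> ?a = ?r \<cdot> ?a"
    by (rule isomorphism_epi[OF ib b comp_in_hom[OF l a] comp_in_hom[OF r a]])
  then show "?l = ?r"
    by (rule isomorphism_epi[OF ia a l r])
qed

section \<open>Scalars\<close>

lemma scale_in_hom [intro]:
  assumes l: "in_hom l (Unit V) (Unit V)" and f: "in_hom f X Y"
  shows "in_hom (scale V l X Y f) X Y"
proof -
  note ob = in_homD[OF f]
  have "in_hom (inverse_arr V (Unit V \<boxtimes> X) X (LUnit V X)) X (Unit V \<boxtimes> X)"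
    by (rule isomorphism_inverse_arr(1)[OF lunit_iso]) (use ob unit_obj in auto)
  then show ?thesis
    unfolding scale_def using l f ob by (blast intro: lunit_in_hom)
qed

text \<open>Clears the inverse unitor from the definition of \<open>scale\<close>. As
  \<open>LUnit V X\<close> can be cancelled on the right, this equation also determines the scaled
  morphism, which is how \<open>scale_eqI\<close> is used.\<close>

lemma scale_lunit:
  assumes l: "in_hom l (Unit V) (Unit V)" and f: "in_hom f X Y"
  shows "scale V l X Y f \<cdot> LUnit V X = LUnit V Y \<cdot> l \<odot> f"
proof -
  note ob = in_homD[OF f] unit_obj
  have iso: "isomorphism V (Unit V \<boxtimes> X) X (LUnit V X)" using lunit_iso ob by blast
  note inv = isomorphism_inverse_arr[OF iso tensor_obj[OF ob(4,1)] ob(1)]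
  let ?d = "inverse_arr V (Unit V \<boxtimes> X) X (LUnit V X)"
  have lf: "in_hom (l \<odot> f) (Unit V \<boxtimes> X) (Unit V \<boxtimes> Y)" using l f by blast
  note lX = lunit_in_hom[OF ob(1)] and lY = lunit_in_hom[OF ob(2)]
  have "scale V l X Y f \<cdot> LUnit V X = LUnit V Y \<cdot> (l \<odot> f \<cdot> ?d) \<cdot> LUnit V X"
    unfolding scale_def using in_hom_assoc[OF lX comp_in_hom[OF lf inv(1)] lY] by simp
  also have "\<dots> = LUnit V Y \<cdot> l \<odot> f"
    using in_hom_assoc[OF lX inv(1) lf] inv(2) comp_ide_right[OF lf] by simp
  finally show ?thesis .
qed

lemma scale_right_runit:
  assumes l: "in_hom l (Unit V) (Unit V)" and f: "in_hom f X Y"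
  shows "in_hom (scale_right V l X Y f) X Y"
    and "scale_right V l X Y f \<cdot> RUnit V X = RUnit V Y \<cdot> f \<odot> l"
proof -
  note ob = in_homD[OF f] unit_obj
  have iso: "isomorphism V (X \<boxtimes> Unit V) X (RUnit V X)" using runit_iso ob by blast
  note inv = isomorphism_inverse_arr[OF iso tensor_obj[OF ob(1,4)] ob(1)]
  let ?d = "inverse_arr V (X \<boxtimes> Unit V) X (RUnit V X)"
  have lf: "in_hom (f \<odot> l) (X \<boxtimes> Unit V) (Y \<boxtimes> Unit V)" using l f by blast
  note rX = runit_in_hom[OF ob(1)] and rY = runit_in_hom[OF ob(2)]
  show "in_hom (scale_right V l X Y f) X Y"
    unfolding scale_right_def by (rule comp_in_hom[OF rY comp_in_hom[OF lf inv(1)]])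
  have "scale_right V l X Y f \<cdot> RUnit V X = RUnit V Y \<cdot> (f \<odot> l \<cdot> ?d) \<cdot> RUnit V X"
    unfolding scale_right_def using in_hom_assoc[OF rX comp_in_hom[OF lf inv(1)] rY] by simp
  also have "\<dots> = RUnit V Y \<cdot> f \<odot> l"
    using in_hom_assoc[OF rX inv(1) lf] inv(2) comp_ide_right[OF lf] by simp
  finally show "scale_right V l X Y f \<cdot> RUnit V X = RUnit V Y \<cdot> f \<odot> l" .
qed

lemma scale_eqI:
  assumes l: "in_hom l (Unit V) (Unit V)" and f: "in_hom f X Y" and h: "in_hom h X Y"
    and eq: "h \<cdot> LUnit V X = LUnit V Y \<cdot> l \<odot> f"
  shows "scale V l X Y f = h"
  using isomorphism_epi[OF lunit_iso lunit_in_hom scale_in_hom[OF l f] h] scale_lunit[OF l f] eq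
    in_homD[OF f] by simp

lemma scale_right_eqI:
  assumes l: "in_hom l (Unit V) (Unit V)" and f: "in_hom f X Y" and h: "in_hom h X Y"
    and eq: "h \<cdot> RUnit V X = RUnit V Y \<cdot> f \<odot> l"
  shows "scale_right V l X Y f = h"
  using isomorphism_epi[OF runit_iso runit_in_hom scale_right_runit(1)[OF l f] h]
    scale_right_runit(2)[OF l f] eq in_homD[OF f] by simp

lemma scale_one:
  assumes f: "in_hom f X Y"
  shows "scale V (Ide V (Unit V)) X Y f = f"
  by (rule scale_eqI) (use f unit_obj lunit_natural in_homD[OF f] in auto)

text \<open>The scalar lives in the first tensor factor and the composition in the second.
  Naturality of the left unitor brings \<open>g\<close> into the second factor, where interchange
  separates the two.\<close>

lemma comp_scale:
  assumes l: "in_hom l (Unit V) (Unit V)" and f: "in_hom f X Y" and g: "in_hom g Y Z"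
  shows "g \<cdot> scale V l X Y f = scale V l X Z (g \<cdot> f)"
proof (rule scale_eqI[OF l, symmetric])
  have i: "in_hom (Ide V (Unit V)) (Unit V) (Unit V)" using unit_obj by blast
  have lf: "in_hom (l \<odot> f) (Unit V \<boxtimes> X) (Unit V \<boxtimes> Y)"
    and ig: "in_hom (Ide V (Unit V) \<odot> g) (Unit V \<boxtimes> Y) (Unit V \<boxtimes> Z)"
    using l f g i by blast+
  note lX = lunit_in_hom[OF in_homD(1)[OF f]] and lY = lunit_in_hom[OF in_homD(1)[OF g]]
    and lZ = lunit_in_hom[OF in_homD(2)[OF g]]
  have "(g \<cdot> scale V l X Y f) \<cdot> LUnit V X = g \<cdot> LUnit V Y \<cdot> l \<odot> f"
    using in_hom_assoc[OF lX scale_in_hom[OF l f] g] scale_lunit[OF l f] by simp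
  also have "\<dots> = (LUnit V Z \<cdot> Ide V (Unit V) \<odot> g) \<cdot> l \<odot> f"
    using in_hom_assoc[OF lf lY g] lunit_natural in_homD[OF g] by simp
  also have "\<dots> = LUnit V Z \<cdot> l \<odot> (g \<cdot> f)"
    using in_hom_assoc[OF lf ig lZ] interchange[OF l i f g] comp_ide_left[OF l] by simp
  finally show "(g \<cdot> scale V l X Y f) \<cdot> LUnit V X = LUnit V Z \<cdot> l \<odot> (g \<cdot> f)" .
qed (use l f g in blast)+

lemma scale_comp:
  assumes l: "in_hom l (Unit V) (Unit V)" and f: "in_hom f X Y" and g: "in_hom g Y Z"
  shows "scale V l Y Z g \<cdot> f = scale V l X Z (g \<cdot> f)"
proof (rule scale_eqI[OF l, symmetric])
  have i: "in_hom (Ide V (Unit V)) (Unit V) (Unit V)" using unit_obj by blast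
  have lg: "in_hom (l \<odot> g) (Unit V \<boxtimes> Y) (Unit V \<boxtimes> Z)"
    and fi: "in_hom (Ide V (Unit V) \<odot> f) (Unit V \<boxtimes> X) (Unit V \<boxtimes> Y)"
    using l f g i by blast+
  note lX = lunit_in_hom[OF in_homD(1)[OF f]] and lY = lunit_in_hom[OF in_homD(1)[OF g]]
    and lZ = lunit_in_hom[OF in_homD(2)[OF g]]
  have "(scale V l Y Z g \<cdot> f) \<cdot> LUnit V X = scale V l Y Z g \<cdot> LUnit V Y \<cdot> Ide V (Unit V) \<odot> f"
    using in_hom_assoc[OF lX f scale_in_hom[OF l g]] lunit_natural in_homD[OF f] by simp
  also have "\<dots> = (LUnit V Z \<cdot> l \<odot> g) \<cdot> Ide V (Unit V) \<odot> f"
    using in_hom_assoc[OF fi lY scale_in_hom[OF l g]] scale_lunit[OF l g] by simp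
  also have "\<dots> = LUnit V Z \<cdot> l \<odot> (g \<cdot> f)"
    using in_hom_assoc[OF fi lg lZ] interchange[OF i l f g] comp_ide_right[OF l] by simp
  finally show "(scale V l Y Z g \<cdot> f) \<cdot> LUnit V X = LUnit V Z \<cdot> l \<odot> (g \<cdot> f)" .
qed (use l f g in blast)+

lemma comp_scale_right:
  assumes l: "in_hom l (Unit V) (Unit V)" and f: "in_hom f X Y" and g: "in_hom g Y Z"
  shows "g \<cdot> scale_right V l X Y f = scale_right V l X Z (g \<cdot> f)"
proof (rule scale_right_eqI[OF l, symmetric])
  have i: "in_hom (Ide V (Unit V)) (Unit V) (Unit V)" using unit_obj by blast
  have lf: "in_hom (f \<odot> l) (X \<boxtimes> Unit V) (Y \<boxtimes> Unit V)"
    and ig: "in_hom (g \<odot> Ide V (Unit V)) (Y \<boxtimes> Unit V) (Z \<boxtimes> Unit V)"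
    using l f g i by blast+
  note rX = runit_in_hom[OF in_homD(1)[OF f]] and rY = runit_in_hom[OF in_homD(1)[OF g]]
    and rZ = runit_in_hom[OF in_homD(2)[OF g]]
  note sc = scale_right_runit[OF l f]
  have "(g \<cdot> scale_right V l X Y f) \<cdot> RUnit V X = g \<cdot> RUnit V Y \<cdot> f \<odot> l"
    using in_hom_assoc[OF rX sc(1) g] sc(2) by simp
  also have "\<dots> = (RUnit V Z \<cdot> g \<odot> Ide V (Unit V)) \<cdot> f \<odot> l"
    using in_hom_assoc[OF lf rY g] runit_natural in_homD[OF g] by simp
  also have "\<dots> = RUnit V Z \<cdot> (g \<cdot> f) \<odot> l"
    using in_hom_assoc[OF lf ig rZ] interchange[OF f g l i] comp_ide_left[OF l] by simp
  finally show "(g \<cdot> scale_right V l X Y f) \<cdot> RUnit V X = RUnit V Z \<cdot> (g \<cdot> f) \<odot> l" .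
qed (use l f g scale_right_runit(1) in blast)+

text \<open>The endomorphisms of the unit act on every hom-set. The outer scalar is realised as
  postcomposition with the scaled identity of the target, so that the two unitor equations can be
  applied one after the other.\<close>

lemma scale_mult:
  assumes l: "in_hom l (Unit V) (Unit V)" and m: "in_hom m (Unit V) (Unit V)"
    and f: "in_hom f X Y"
  shows "scale V (l \<cdot> m) X Y f = scale V l X Y (scale V m X Y f)"
proof (rule scale_eqI)
  note ob = in_homD[OF f]
  have i: "in_hom (Ide V Y) Y Y" using ob by blast
  note mf = scale_in_hom[OF m f] and li = scale_in_hom[OF l i]
  note lX = lunit_in_hom[OF ob(1)] and lY = lunit_in_hom[OF ob(2)]
  have mf': "in_hom (m \<odot> f) (Unit V \<boxtimes> X) (Unit V \<boxtimes> Y)"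
    and li': "in_hom (l \<odot> Ide V Y) (Unit V \<boxtimes> Y) (Unit V \<boxtimes> Y)"
    using l m f i by blast+
  have "scale V l X Y (scale V m X Y f) \<cdot> LUnit V X
      = scale V l Y Y (Ide V Y) \<cdot> scale V m X Y f \<cdot> LUnit V X"
    using scale_comp[OF l mf i] comp_ide_left[OF mf] in_hom_assoc[OF lX mf li] by simp
  also have "\<dots> = (LUnit V Y \<cdot> l \<odot> Ide V Y) \<cdot> m \<odot> f"
    using scale_lunit[OF m f] in_hom_assoc[OF mf' lY li] scale_lunit[OF l i] by simp
  also have "\<dots> = LUnit V Y \<cdot> (l \<cdot> m) \<odot> f"
    using in_hom_assoc[OF mf' li' lY] interchange[OF m l f i] comp_ide_left[OF f] by simp
  finally show "scale V l X Y (scale V m X Y f) \<cdot> LUnit V X = LUnit V Y \<cdot> (l \<cdot> m) \<odot> f" .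
qed (use l m f in blast)+

text \<open>By Kelly's law the left unitor of X \<otimes> Y is, up to the associator, that of X
  tensored with Y; so a scalar in front of a product acts on its first factor.\<close>

lemma scale_tensor:
  assumes l: "in_hom l (Unit V) (Unit V)" and f: "in_hom f X X'" and g: "in_hom g Y Y'"
  shows "scale V l (X \<boxtimes> Y) (X' \<boxtimes> Y') (f \<odot> g) = scale V l X X' f \<odot> g"
proof (rule scale_eqI[OF l])
  let ?I = "Unit V" and ?s = "scale V l X X' f"
  note ob [intro] = in_homD(1,2)[OF f] in_homD(1,2)[OF g] unit_obj
  note s = scale_in_hom[OF l f]
  show fg: "in_hom (f \<odot> g) (X \<boxtimes> Y) (X' \<boxtimes> Y')" and sg: "in_hom (?s \<odot> g) (X \<boxtimes> Y) (X' \<boxtimes> Y')"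
    using f g s by blast+
  have iY: "in_hom (Ide V Y) Y Y" "in_hom (Ide V Y') Y' Y'" by blast+
  have lX: "in_hom (LUnit V X) (?I \<boxtimes> X) X" "in_hom (LUnit V X') (?I \<boxtimes> X') X'" by blast+
  have lXY: "in_hom (LUnit V (X \<boxtimes> Y)) (?I \<boxtimes> X \<boxtimes> Y) (X \<boxtimes> Y)"
    "in_hom (LUnit V (X' \<boxtimes> Y')) (?I \<boxtimes> X' \<boxtimes> Y') (X' \<boxtimes> Y')" by blast+
  have a: "in_hom (Assoc V ?I X Y) ((?I \<boxtimes> X) \<boxtimes> Y) (?I \<boxtimes> X \<boxtimes> Y)"
    "in_hom (Assoc V ?I X' Y') ((?I \<boxtimes> X') \<boxtimes> Y') (?I \<boxtimes> X' \<boxtimes> Y')" by blast+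
  have lf: "in_hom (l \<odot> f) (?I \<boxtimes> X) (?I \<boxtimes> X')" using l f by blast
  have lfg: "in_hom ((l \<odot> f) \<odot> g) ((?I \<boxtimes> X) \<boxtimes> Y) ((?I \<boxtimes> X') \<boxtimes> Y')"
    "in_hom (l \<odot> f \<odot> g) (?I \<boxtimes> X \<boxtimes> Y) (?I \<boxtimes> X' \<boxtimes> Y')" using l f g by blast+
  have "(?s \<odot> g \<cdot> LUnit V (X \<boxtimes> Y)) \<cdot> Assoc V ?I X Y = ?s \<odot> g \<cdot> LUnit V X \<odot> Ide V Y"
    using in_hom_assoc[OF a(1) lXY(1) sg] lunit_tensor[of X Y] ob by simp
  also have "\<dots> = (LUnit V X' \<cdot> l \<odot> f) \<odot> g"
    using interchange[OF lX(1) s iY(1) g] scale_lunit[OF l f] comp_ide_right[OF g] by simp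
  also have "\<dots> = LUnit V X' \<odot> Ide V Y' \<cdot> (l \<odot> f) \<odot> g"
    using interchange[OF lf lX(2) g iY(2)] comp_ide_left[OF g] by simp
  also have "\<dots> = LUnit V (X' \<boxtimes> Y') \<cdot> Assoc V ?I X' Y' \<cdot> (l \<odot> f) \<odot> g"
    using in_hom_assoc[OF lfg(1) a(2) lXY(2)] lunit_tensor[of X' Y'] ob by simp
  also have "\<dots> = (LUnit V (X' \<boxtimes> Y') \<cdot> l \<odot> f \<odot> g) \<cdot> Assoc V ?I X Y"
    using assoc_natural[of ?I X Y ?I X' Y' l f g] in_hom_assoc[OF a(1) lfg(2) lXY(2)]
      l f g by (simp add: in_hom_def)
  finally show "?s \<odot> g \<cdot> LUnit V (X \<boxtimes> Y) = LUnit V (X' \<boxtimes> Y') \<cdot> l \<odot> f \<odot> g"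
    by (rule isomorphism_epi[OF assoc_iso[OF ob(5,1,3)] a(1)
          comp_in_hom[OF sg lXY(1)] comp_in_hom[OF lXY(2) lfg(2)]])
qed

text \<open>Both sides are the morphism f \<otimes> l \<otimes> g with the middle unit removed: the
  triangle says that the right unitor of the first factor and the left unitor of the second remove
  it in the same way.\<close>

lemma scale_right_tensor:
  assumes l: "in_hom l (Unit V) (Unit V)" and f: "in_hom f X X'" and g: "in_hom g Y Y'"
  shows "scale_right V l X X' f \<odot> g = f \<odot> scale V l Y Y' g"
proof -
  let ?I = "Unit V" and ?r = "scale_right V l X X' f" and ?s = "scale V l Y Y' g"
  note ob [intro] = in_homD(1,2)[OF f] in_homD(1,2)[OF g] unit_obj
  note s = scale_in_hom[OF l g] and r = scale_right_runit[OF l f]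
  have fs: "in_hom (f \<odot> ?s) (X \<boxtimes> Y) (X' \<boxtimes> Y')" and rg: "in_hom (?r \<odot> g) (X \<boxtimes> Y) (X' \<boxtimes> Y')"
    using f g s r by blast+
  have i: "in_hom (Ide V X) X X" "in_hom (Ide V X') X' X'"
    "in_hom (Ide V Y) Y Y" "in_hom (Ide V Y') Y' Y'" by blast+
  have rX: "in_hom (RUnit V X) (X \<boxtimes> ?I) X" "in_hom (RUnit V X') (X' \<boxtimes> ?I) X'" by blast+
  have lY: "in_hom (LUnit V Y) (?I \<boxtimes> Y) Y" "in_hom (LUnit V Y') (?I \<boxtimes> Y') Y'" by blast+
  have a: "in_hom (Assoc V X ?I Y) ((X \<boxtimes> ?I) \<boxtimes> Y) (X \<boxtimes> ?I \<boxtimes> Y)"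
    "in_hom (Assoc V X' ?I Y') ((X' \<boxtimes> ?I) \<boxtimes> Y') (X' \<boxtimes> ?I \<boxtimes> Y')" by blast+
  have fl: "in_hom (f \<odot> l) (X \<boxtimes> ?I) (X' \<boxtimes> ?I)" and lg: "in_hom (l \<odot> g) (?I \<boxtimes> Y) (?I \<boxtimes> Y')"
    using l f g by blast+
  have flg: "in_hom ((f \<odot> l) \<odot> g) ((X \<boxtimes> ?I) \<boxtimes> Y) ((X' \<boxtimes> ?I) \<boxtimes> Y')"
    "in_hom (f \<odot> l \<odot> g) (X \<boxtimes> ?I \<boxtimes> Y) (X' \<boxtimes> ?I \<boxtimes> Y')" using l f g by blast+
  have XlY: "in_hom (Ide V X \<odot> LUnit V Y) (X \<boxtimes> ?I \<boxtimes> Y) (X \<boxtimes> Y)"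
    "in_hom (Ide V X' \<odot> LUnit V Y') (X' \<boxtimes> ?I \<boxtimes> Y') (X' \<boxtimes> Y')" by blast+
  have iso: "isomorphism V (X \<boxtimes> ?I \<boxtimes> Y) (X \<boxtimes> Y) (Ide V X \<odot> LUnit V Y)"
    by (rule tensor_isomorphism) (use ob ide_isomorphism lunit_iso in blast)+
  have "(?r \<odot> g \<cdot> Ide V X \<odot> LUnit V Y) \<cdot> Assoc V X ?I Y = ?r \<odot> g \<cdot> RUnit V X \<odot> Ide V Y"
    using in_hom_assoc[OF a(1) XlY(1) rg] triangle[of X Y] ob by simp
  also have "\<dots> = (RUnit V X' \<cdot> f \<odot> l) \<odot> g"
    using interchange[OF rX(1) r(1) i(3) g] r(2) comp_ide_right[OF g] by simp
  also have "\<dots> = RUnit V X' \<odot> Ide V Y' \<cdot> (f \<odot> l) \<odot> g"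
    using interchange[OF fl rX(2) g i(4)] comp_ide_left[OF g] by simp
  also have "\<dots> = Ide V X' \<odot> LUnit V Y' \<cdot> Assoc V X' ?I Y' \<cdot> (f \<odot> l) \<odot> g"
    using in_hom_assoc[OF flg(1) a(2) XlY(2)] triangle[of X' Y'] ob by simp
  also have "\<dots> = (Ide V X' \<odot> LUnit V Y' \<cdot> f \<odot> l \<odot> g) \<cdot> Assoc V X ?I Y"
    using assoc_natural[of X ?I Y X' ?I Y' f l g] in_hom_assoc[OF a(1) flg(2) XlY(2)]
      l f g by (simp add: in_hom_def)
  also have "Ide V X' \<odot> LUnit V Y' \<cdot> f \<odot> l \<odot> g = f \<odot> ?s \<cdot> Ide V X \<odot> LUnit V Y"
    using interchange[OF f i(2) lg lY(2)] interchange[OF i(1) f lY(1) s] scale_lunit[OF l g]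
      comp_ide_left[OF f] comp_ide_right[OF f] by simp
  finally have "?r \<odot> g \<cdot> Ide V X \<odot> LUnit V Y = f \<odot> ?s \<cdot> Ide V X \<odot> LUnit V Y"
    by (rule isomorphism_epi[OF assoc_iso[OF ob(1,5,3)] a(1)
          comp_in_hom[OF rg XlY(1)] comp_in_hom[OF fs XlY(1)]])
  then show ?thesis
    by (rule isomorphism_epi[OF iso XlY(1) rg fs])
qed

text \<open>Centrality is a statement about identities. Postcomposing with \<open>f\<close> extends
  it to an arbitrary morphism, and then the scalar goes from the second factor to the right of the
  first, to the left of the first, and out.\<close>

lemma tensor_scale:
  assumes central: "central_scalar V l" and l: "in_hom l (Unit V) (Unit V)"
    and f: "in_hom f X X'" and g: "in_hom g Y Y'"
  shows "f \<odot> scale V l Y Y' g = scale V l (X \<boxtimes> Y) (X' \<boxtimes> Y') (f \<odot> g)"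
proof -
  have i: "in_hom (Ide V X) X X" using in_homD[OF f] by blast
  have "scale_right V l X X (Ide V X) = scale V l X X (Ide V X)"
    using central in_homD[OF f] by (simp add: central_scalar_def)
  then have "scale_right V l X X' f = scale V l X X' f"
    using comp_scale_right[OF l i f] comp_scale[OF l i f] comp_ide_right[OF f] by simp
  then show ?thesis
    using scale_right_tensor[OF l f g] scale_tensor[OF l f g] by simp
qed

section \<open>Powers of the scalar\<close>

lemma scalar_power_in_hom [intro]:
  "in_hom l (Unit V) (Unit V) \<Longrightarrow> in_hom (scalar_power V l k) (Unit V) (Unit V)"
  unfolding scalar_power_def by (induction k) (auto simp: unit_obj)

lemma scale_power_0: "in_hom f X Y \<Longrightarrow> scale V (scalar_power V l 0) X Y f = f"
  by (simp add: scalar_power_def scale_one)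

lemma scale_power_Suc:
  assumes "in_hom l (Unit V) (Unit V)" "in_hom f X Y"
  shows "scale V (scalar_power V l (Suc k)) X Y f
    = scale V l X Y (scale V (scalar_power V l k) X Y f)"
  using scale_mult[OF assms(1) scalar_power_in_hom[OF assms(1)] assms(2)]
  by (simp add: scalar_power_def)

lemma scale_power_add:
  assumes l: "in_hom l (Unit V) (Unit V)" and f: "in_hom f X Y"
  shows "scale V (scalar_power V l (j + k)) X Y f
    = scale V (scalar_power V l j) X Y (scale V (scalar_power V l k) X Y f)"
proof (induction j)
  case 0
  show ?case
    using scale_power_0[OF scale_in_hom[OF scalar_power_in_hom[OF l] f], of l k] by simp
next
  case (Suc j)
  have "in_hom (scale V (scalar_power V l k) X Y f) X Y" using l f by blast
  then show ?case using Suc scale_power_Suc[OF l] f by simp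
qed

text \<open>Powers on the first factor come out at once, as any scalar does. Those on the second
  come out one factor \<open>l\<close> at a time, because it is \<open>l\<close> that is assumed
  central.\<close>

lemma scale_power_tensor:
  assumes central: "central_scalar V l" and l: "in_hom l (Unit V) (Unit V)"
    and f: "in_hom f X X'" and g: "in_hom g Y Y'"
  shows "scale V (scalar_power V l j) X X' f \<odot> scale V (scalar_power V l k) Y Y' g
    = scale V (scalar_power V l (j + k)) (X \<boxtimes> Y) (X' \<boxtimes> Y') (f \<odot> g)"
proof -
  have "f \<odot> scale V (scalar_power V l k) Y Y' g
    = scale V (scalar_power V l k) (X \<boxtimes> Y) (X' \<boxtimes> Y') (f \<odot> g)"
  proof (induction k)
    case 0
    show ?case using scale_power_0 f g tensor_in_hom[OF f g] by simp
  next
    case (Suc k)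
    show ?case
      using scale_power_Suc[OF l] g tensor_in_hom[OF f g] Suc
        tensor_scale[OF central l f scale_in_hom[OF scalar_power_in_hom[OF l] g]] by simp
  qed
  then show ?thesis
    using scale_tensor[OF scalar_power_in_hom[OF l] f scale_in_hom[OF scalar_power_in_hom[OF l] g],
        of j k] scale_power_add[OF l tensor_in_hom[OF f g], of j k] by simp
qed

end

section \<open>Sums of morphisms\<close>

text \<open>\<open>S\<close> may be infinite: \<open>finprod\<close> is then the neutral element,
  which a homomorphism preserves.\<close>

lemma hom_finprod:
  assumes "comm_group G" "comm_group K" and h: "h \<in> hom G K" and f: "f \<in> S \<rightarrow> carrier G"
  shows "h (finprod G f S) = finprod K (\<lambda>x. h (f x)) S"
proof -
  interpret G: comm_group G by fact
  interpret K: comm_group K by fact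
  have one: "h \<one>\<^bsub>G\<^esub> = \<one>\<^bsub>K\<^esub>" using hom_one[OF h G.is_group K.is_group] .
  show ?thesis using f
  proof (induction S rule: infinite_finite_induct)
    case (insert x S)
    then have "h (finprod G f (insert x S)) = h (f x) \<otimes>\<^bsub>K\<^esub> finprod K (\<lambda>x. h (f x)) S"
      by (simp add: hom_mult[OF h] Pi_def)
    also have "\<dots> = finprod K (\<lambda>x. h (f x)) (insert x S)"
      using insert.hyps insert.prems by (subst K.finprod_insert) (auto intro: hom_in_carrier[OF h])
    finally show ?case .
  qed (simp_all add: one)
qed

context additive_category
begin

lemma hom_comm_monoid: "\<lbrakk>X \<in> Obj C; Y \<in> Obj C\<rbrakk> \<Longrightarrow> comm_monoid (H X Y)"
  using hom_group comm_group_def by blast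

lemma in_carrier_iff: "\<lbrakk>X \<in> Obj C; Y \<in> Obj C\<rbrakk> \<Longrightarrow> f \<in> carrier (H X Y) \<longleftrightarrow> in_hom f X Y"
  by (simp add: hom_carrier in_hom_def)

lemma zero_in_hom [intro]: "\<lbrakk>X \<in> Obj C; Y \<in> Obj C\<rbrakk> \<Longrightarrow> in_hom (zero_arr H X Y) X Y"
  using monoid.one_closed[OF comm_monoid.axioms(1)[OF hom_comm_monoid], of X Y]
    in_carrier_iff[of X Y] by simp

lemma add_in_hom [intro]: "\<lbrakk>in_hom f X Y; in_hom g X Y\<rbrakk> \<Longrightarrow> in_hom (add_arr H X Y f g) X Y"
  using monoid.m_closed[OF comm_monoid.axioms(1)[OF hom_comm_monoid], of X Y f g]
    in_carrier_iff[of X Y] in_homD[of f X Y] by simp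

lemma sum_in_hom [intro]:
  "\<lbrakk>X \<in> Obj C; Y \<in> Obj C; \<And>r. r \<in> S \<Longrightarrow> in_hom (f r) X Y\<rbrakk> \<Longrightarrow> in_hom (sum_arr H X Y f S) X Y"
  using comm_monoid.finprod_closed[OF hom_comm_monoid, of X Y f S] in_carrier_iff by blast

lemma sum_cong:
  assumes "X \<in> Obj C" "Y \<in> Obj C" "\<And>r. r \<in> S \<Longrightarrow> f r = g r" "\<And>r. r \<in> S \<Longrightarrow> in_hom (g r) X Y"
  shows "sum_arr H X Y f S = sum_arr H X Y g S"
  using comm_monoid.finprod_cong'[OF hom_comm_monoid, of X Y S S g f] assms in_carrier_iff by blast

text \<open>Stated for an arbitrary additive map because composing with a fixed morphism, tensoring
  with one, and scaling must all be distributed over sums.\<close>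

lemma
  assumes ob: "X \<in> Obj C" "Y \<in> Obj C" "X' \<in> Obj C" "Y' \<in> Obj C"
    and h: "h \<in> hom (H X Y) (H X' Y')"
  shows additive_add: "\<lbrakk>in_hom f X Y; in_hom g X Y\<rbrakk>
      \<Longrightarrow> h (add_arr H X Y f g) = add_arr H X' Y' (h f) (h g)"
    and additive_sum: "(\<And>r. r \<in> S \<Longrightarrow> in_hom (k r) X Y)
      \<Longrightarrow> h (sum_arr H X Y k S) = sum_arr H X' Y' (\<lambda>r. h (k r)) S"
proof -
  note cg = hom_group[OF ob(1,2)] hom_group[OF ob(3,4)]
  show "h (add_arr H X Y f g) = add_arr H X' Y' (h f) (h g)" if "in_hom f X Y" "in_hom g X Y"
    using hom_mult[OF h] that in_carrier_iff ob by blast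
  show "h (sum_arr H X Y k S) = sum_arr H X' Y' (\<lambda>r. h (k r)) S"
    if "\<And>r. r \<in> S \<Longrightarrow> in_hom (k r) X Y"
    by (rule hom_finprod[OF cg h]) (use that in_carrier_iff ob in blast)
qed

lemma comp_hom_right:
  "\<lbrakk>X \<in> Obj C; in_hom g Y Z\<rbrakk> \<Longrightarrow> (\<lambda>f. g \<cdot> f) \<in> hom (H X Y) (H X Z)"
  by (rule comp_additive_right) (simp_all add: in_hom_def)

lemma comp_hom_left:
  "\<lbrakk>Z \<in> Obj C; in_hom f X Y\<rbrakk> \<Longrightarrow> (\<lambda>g. g \<cdot> f) \<in> hom (H Y Z) (H X Z)"
  by (rule comp_additive_left) (simp_all add: in_hom_def)

lemma comp_add:
  assumes g: "in_hom g Y Z" and f: "in_hom f X Y" "in_hom f' X Y"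
  shows "g \<cdot> add_arr H X Y f f' = add_arr H X Z (g \<cdot> f) (g \<cdot> f')"
proof -
  note ob = in_homD(1)[OF f(1)] in_homD(1,2)[OF g]
  show ?thesis by (rule additive_add[OF ob(1,2,1,3) comp_hom_right[OF ob(1) g] f])
qed

lemma add_comp:
  assumes f: "in_hom f X Y" and g: "in_hom g Y Z" "in_hom g' Y Z"
  shows "add_arr H Y Z g g' \<cdot> f = add_arr H X Z (g \<cdot> f) (g' \<cdot> f)"
proof -
  note ob = in_homD(1)[OF f] in_homD(1,2)[OF g(1)]
  show ?thesis by (rule additive_add[OF ob(2,3,1,3) comp_hom_left[OF ob(3) f] g])
qed

end

section \<open>Additivity of tensoring and scaling; typing of bracketed products\<close>

context monoidal_additive_category
begin

lemma tensor_hom_left: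
  "\<lbrakk>X \<in> Obj V; X' \<in> Obj V; in_hom g Y Y'\<rbrakk>
    \<Longrightarrow> (\<lambda>f. f \<odot> g) \<in> hom (H X X') (H (X \<boxtimes> Y) (X' \<boxtimes> Y'))"
  by (rule tensor_additive_left) (simp_all add: in_hom_def)

lemma tensor_hom_right:
  "\<lbrakk>Y \<in> Obj V; Y' \<in> Obj V; in_hom f X X'\<rbrakk>
    \<Longrightarrow> (\<lambda>g. f \<odot> g) \<in> hom (H Y Y') (H (X \<boxtimes> Y) (X' \<boxtimes> Y'))"
  by (rule tensor_additive_right) (simp_all add: in_hom_def)

text \<open>Scaling is a composite of three additive maps: tensoring with \<open>l\<close>,
  precomposing with the inverse unitor, postcomposing with the unitor.\<close>

lemma scale_hom:
  assumes l: "in_hom l (Unit V) (Unit V)" and ob: "X \<in> Obj V" "Y \<in> Obj V"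
  shows "scale V l X Y \<in> hom (H X Y) (H X Y)"
proof -
  let ?I = "Unit V" and ?d = "inverse_arr V (Unit V \<boxtimes> X) X (LUnit V X)"
  note ob' = ob unit_obj tensor_obj[OF unit_obj ob(1)] tensor_obj[OF unit_obj ob(2)]
  have d: "in_hom ?d X (?I \<boxtimes> X)"
    by (rule isomorphism_inverse_arr(1)[OF lunit_iso]) (use ob' in auto)
  note h = tensor_hom_right[OF ob l] comp_hom_left[OF ob'(5) d]
    comp_hom_right[OF ob(1) lunit_in_hom[OF ob(2)]]
  show ?thesis
    using Group.hom_compose[OF Group.hom_compose[OF h(1,2)] h(3)]
    by (simp add: scale_def[abs_def] comp_def)
qed

lemma word_arr_in_hom:
  "(\<And>i. i \<in> {1..len w} \<Longrightarrow> in_hom (f i) (X i) (Y i))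
    \<Longrightarrow> in_hom (word_arr V w f) (word_obj V w X) (word_obj V w Y)"
proof (induction w arbitrary: f X Y)
  case Empty
  then show ?case using unit_obj by auto
next
  case (Join u v)
  have "in_hom (word_arr V u f) (word_obj V u X) (word_obj V u Y)"
    "in_hom (word_arr V v (\<lambda>i. f (len u + i))) (word_obj V v (\<lambda>i. X (len u + i)))
      (word_obj V v (\<lambda>i. Y (len u + i)))"
    by (rule Join.IH; use Join.prems in simp)+
  then show ?case by auto
qed simp

end

lemma word_arr_cong:
  "(\<And>i. i \<in> {1..len w} \<Longrightarrow> f i = g i) \<Longrightarrow> word_arr V w f = word_arr V w g"
proof (induction w arbitrary: f g)
  case (Join u v)
  have "word_arr V u f = word_arr V u g"
    "word_arr V v (\<lambda>i. f (len u + i)) = word_arr V v (\<lambda>i. g (len u + i))"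
    by (rule Join.IH; use Join.prems in simp)+
  then show ?case by simp
qed simp_all

text \<open>The case n = 2 written out as an operation on graphs. The product in
  \<open>Gph_monoidal\<close> is defined through the sum over subsets instead; this form is what the
  recursion over \<open>Join\<close> produces.\<close>

definition binary_tensor :: "('o, 'm, 'z) monoidal_data_scheme \<Rightarrow> ('o \<Rightarrow> 'o \<Rightarrow> 'm monoid) \<Rightarrow> 'm \<Rightarrow>
    ('o, 'm) graph \<Rightarrow> ('o, 'm) graph \<Rightarrow> ('o, 'm) graph" where
  "binary_tensor V H l G K =
     (let E = edg G \<boxtimes>\<^bsub>V\<^esub> edg K; A = ver G \<boxtimes>\<^bsub>V\<^esub> ver K in
      \<lparr>ver = A, edg = E,
       src = add_arr H E A
               (add_arr H E A (scale V l E A (src G \<odot>\<^bsub>V\<^esub> src K)) (src G \<odot>\<^bsub>V\<^esub> tgt K))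
               (tgt G \<odot>\<^bsub>V\<^esub> src K),
       tgt = tgt G \<odot>\<^bsub>V\<^esub> tgt K\<rparr>)"

lemma Obj_Gph_iff:
  "G \<in> Obj (Gph V) \<longleftrightarrow> ver G \<in> Obj V \<and> edg G \<in> Obj V \<and>
     src G \<in> Hom V (edg G) (ver G) \<and> tgt G \<in> Hom V (edg G) (ver G)"
  by (simp add: Gph_def)

section \<open>Iterated tensor products of graphs\<close>

text \<open>The map \<open>(+) n\<close> carries {1..m} onto the second block, so R corresponds to
  its trace on the first block and its trace on the second, shifted back. Pairs are enumerated as a
  union indexed by the first trace, ready for the summation over a disjoint union.\<close>

lemma nonempty_subsets_add:
  fixes n m :: nat
  defines "P \<equiv> \<lambda>k. {R. R \<noteq> {} \<and> R \<subseteq> {1..k}}"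
  shows "P (n + m) = (\<Union>R\<in>P n. (\<lambda>R'. R \<union> (+) n ` R') ` P m) \<union> P n \<union> (`) ((+) n) ` P m"
    (is "_ = ?U")
proof (intro equalityI subsetI)
  fix R assume R: "R \<in> P (n + m)"
  define R1 R2 where "R1 = R \<inter> {1..n}" and "R2 = {i \<in> {1..m}. n + i \<in> R}"
  have "i \<in> R1 \<union> (+) n ` R2" if "i \<in> R" for i
  proof (cases "i \<le> n")
    case False
    then have "i = n + (i - n)" "i - n \<in> R2" using R that by (auto simp: P_def R2_def)
    then show ?thesis by blast
  qed (use R that in \<open>auto simp: P_def R1_def\<close>)
  moreover have "R1 \<union> (+) n ` R2 \<subseteq> R" by (auto simp: R1_def R2_def)
  ultimately have eq: "R = R1 \<union> (+) n ` R2" by blast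
  have "R1 \<in> P n \<longleftrightarrow> R1 \<noteq> {}" "R2 \<in> P m \<longleftrightarrow> R2 \<noteq> {}"
    by (auto simp: P_def R1_def R2_def)
  moreover have "R \<noteq> {}" using R by (simp add: P_def)
  then have "R1 \<noteq> {} \<or> R2 \<noteq> {}" unfolding eq by auto
  ultimately consider "R1 \<in> P n" "R2 \<in> P m" | "R1 \<in> P n" "R2 = {}" | "R1 = {}" "R2 \<in> P m"
    by argo
  then show "R \<in> ?U" unfolding eq by cases auto
next
  fix R assume "R \<in> ?U"
  then consider R1 R2 where "R1 \<in> P n" "R2 \<in> P m" "R = R1 \<union> (+) n ` R2"
    | "R \<in> P n" | R2 where "R2 \<in> P m" "R = (+) n ` R2"
    by blast
  then show "R \<in> P (n + m)" by cases (force simp: P_def)+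
qed

context monoidal_additive_category
begin

text \<open>The only subset is {1}; its exponent is 0, so the scalar disappears.\<close>

lemma graph_tensor_Slot: "G 1 \<in> Obj (Gph V) \<Longrightarrow> graph_tensor V H l Slot G = G 1"
proof -
  assume G: "G 1 \<in> Obj (Gph V)"
  then have s: "in_hom (src (G 1)) (edg (G 1)) (ver (G 1))" by (simp add: Obj_Gph_iff in_hom_def)
  have "{R. R \<noteq> {} \<and> R \<subseteq> {1..len Slot}} = {{1::nat}}" by auto
  moreover have "sum_arr H (edg (G 1)) (ver (G 1)) f {{1}} = f {1}"
    if f: "in_hom (f {1}) (edg (G 1)) (ver (G 1))" for f :: "nat set \<Rightarrow> 'm"
  proof -
    interpret M: comm_monoid "H (edg (G 1)) (ver (G 1))"
      using hom_comm_monoid in_homD[OF s] by simp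
    have "f {1} \<in> carrier (H (edg (G 1)) (ver (G 1)))"
      using f in_homD[OF s] in_carrier_iff by simp
    then show ?thesis using M.finprod_insert[of "{}" "{1}" f] M.finprod_empty[of f]
        M.r_one[of "f {1}"] by simp
  qed
  ultimately show ?thesis
    using s scale_power_0[OF s, of l] by (simp add: graph_tensor_def chi_def Let_def)
qed

text \<open>The summand \<open>h R\<close> of the joined word is matched, for each of the three
  kinds of subset, with products of the summands \<open>f\<close> and \<open>g\<close> of the two
  subwords and their targets. Biadditivity of the tensor product then factors the three partial
  sums.\<close>

lemma graph_tensor_Join:
  assumes central: "central_scalar V l" and l: "in_hom l (Unit V) (Unit V)"
    and G: "\<And>i. i \<in> {1..len u + len v} \<Longrightarrow> G i \<in> Obj (Gph V)"
  shows "graph_tensor V H l (Join u v) G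
    = binary_tensor V H l (graph_tensor V H l u G) (graph_tensor V H l v (\<lambda>i. G (len u + i)))"
proof -
  define n m where "n = len u" and "m = len v"
  define P :: "nat \<Rightarrow> nat set set" where "P k = {R. R \<noteq> {} \<and> R \<subseteq> {1..k}}" for k
  define G' where "G' i = G (n + i)" for i
  define A1 E1 A2 E2 where "A1 = word_obj V u (\<lambda>i. ver (G i))" and "E1 = word_obj V u (\<lambda>i. edg (G i))"
    and "A2 = word_obj V v (\<lambda>i. ver (G' i))" and "E2 = word_obj V v (\<lambda>i. edg (G' i))"
  let ?E = "E1 \<boxtimes> E2" and ?A = "A1 \<boxtimes> A2"
  define f where "f R = scale V (scalar_power V l (card R - 1)) E1 A1 (word_arr V u (chi G R))" for R
  define g where "g R = scale V (scalar_power V l (card R - 1)) E2 A2 (word_arr V v (chi G' R))" for R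
  define h where "h R = scale V (scalar_power V l (card R - 1)) ?E ?A
    (word_arr V u (chi G R) \<odot> word_arr V v (\<lambda>i. chi G R (n + i)))" for R
  define t1 t2 where "t1 = word_arr V u (\<lambda>i. tgt (G i))" and "t2 = word_arr V v (\<lambda>i. tgt (G' i))"
  define s1 s2 where "s1 = sum_arr H E1 A1 f (P n)" and "s2 = sum_arr H E2 A2 g (P m)"
  have chi1: "in_hom (chi G R i) (edg (G i)) (ver (G i))" if "i \<in> {1..n + m}" for R i
    using G[of i] that by (auto simp: n_def m_def chi_def Obj_Gph_iff in_hom_def)
  have x: "in_hom (word_arr V u (chi G R)) E1 A1" for R
    unfolding E1_def A1_def by (rule word_arr_in_hom) (use chi1 in \<open>simp add: n_def\<close>)
  have y': "in_hom (word_arr V v (\<lambda>i. chi G R (n + i))) E2 A2" for R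
    unfolding E2_def A2_def by (rule word_arr_in_hom) (use chi1 in \<open>simp add: m_def G'_def\<close>)
  \<comment> \<open>The target is the summand that the empty subset would contribute, so its typing
    is an instance of the general one.\<close>
  have t1_eq: "t1 = word_arr V u (chi G {})"
    unfolding t1_def by (rule word_arr_cong) (simp add: chi_def)
  have y: "in_hom (word_arr V v (chi G' R)) E2 A2" for R
  proof -
    have "in_hom (chi G' R i) (edg (G' i)) (ver (G' i))" if "i \<in> {1..m}" for i
      using G[of "n + i"] that by (auto simp: n_def m_def chi_def G'_def Obj_Gph_iff in_hom_def)
    then show ?thesis unfolding E2_def A2_def m_def by (rule word_arr_in_hom)
  qed
  have t2_eq: "t2 = word_arr V v (chi G' {})"
    unfolding t2_def by (rule word_arr_cong) (simp add: chi_def)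
  have t: "in_hom t1 E1 A1" "in_hom t2 E2 A2" using x[of "{}"] y[of "{}"] t1_eq t2_eq by auto
  note ob = in_homD(1,2)[OF t(1)] in_homD(1,2)[OF t(2)]
  note obE = tensor_obj[OF ob(1,3)] and obA = tensor_obj[OF ob(2,4)]
  note pow = scalar_power_in_hom[OF l]
  have f: "in_hom (f R) E1 A1" and g: "in_hom (g R) E2 A2" and h: "in_hom (h R) ?E ?A" for R
    unfolding f_def g_def h_def using pow x y y' by blast+
  have s: "in_hom s1 E1 A1" "in_hom s2 E2 A2"
    unfolding s1_def s2_def using f g ob by blast+
  have fin: "finite (P k)" for k by (simp add: P_def)
  have h1: "h R = f R \<odot> t2" if R: "R \<in> P n" for R
  proof -
    have "word_arr V v (\<lambda>i. chi G R (n + i)) = t2"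
      unfolding t2_def by (rule word_arr_cong) (use R in \<open>auto simp: P_def chi_def G'_def\<close>)
    then show ?thesis
      using scale_tensor[OF pow x t(2)] by (simp add: h_def f_def)
  qed
  \<comment> \<open>Slots are numbered from 1, so a subset of {1..n} contains no index n + i of the
    second block.\<close>
  have v_shift: "word_arr V v (\<lambda>i. chi G (R \<union> (+) n ` R') (n + i)) = word_arr V v (chi G' R')"
    if R: "R \<subseteq> {1..n}" for R R'
    by (rule word_arr_cong) (use R in \<open>auto simp: chi_def G'_def\<close>)
  have h2: "h ((+) n ` R) = t1 \<odot> g R" if R: "R \<in> P m" for R
  proof -
    have "word_arr V u (chi G ((+) n ` R)) = t1"
      unfolding t1_def by (rule word_arr_cong) (use R in \<open>auto simp: P_def chi_def n_def\<close>)
    moreover have "card ((+) n ` R) = card R" by (simp add: card_image)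
    ultimately show ?thesis
      using scale_power_tensor[OF central l t(1) y, of 0 "card R - 1" R] v_shift[of "{}" R]
        scale_power_0[OF t(1), of l]
      by (simp add: h_def g_def)
  qed
  have h3: "h (R \<union> (+) n ` R') = scale V l ?E ?A (f R \<odot> g R')" if R: "R \<in> P n" "R' \<in> P m" for R R'
  proof -
    have "word_arr V u (chi G (R \<union> (+) n ` R')) = word_arr V u (chi G R)"
      by (rule word_arr_cong) (use R in \<open>auto simp: P_def chi_def n_def\<close>)
    \<comment> \<open>Both blocks are nonempty, so the natural-number subtractions do not truncate;
      the \<open>Suc\<close> is the factor \<open>l\<close> in front of s \<otimes> s.\<close>
    moreover have "card (R \<union> (+) n ` R') - 1 = Suc ((card R - 1) + (card R' - 1))"
    proof -
      have fin: "finite R" "finite R'" using R by (auto simp: P_def intro: finite_subset)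
      have "i \<le> n" if "i \<in> R" for i using that R by (auto simp: P_def)
      moreover have "n < i" if "i \<in> (+) n ` R'" for i using that R by (auto simp: P_def)
      ultimately have "R \<inter> (+) n ` R' = {}" by fastforce
      then have "card (R \<union> (+) n ` R') = card R + card ((+) n ` R')"
        using fin by (simp add: card_Un_disjoint)
      moreover have "card R > 0" "card R' > 0" using R fin by (auto simp: P_def card_gt_0_iff)
      ultimately show ?thesis by (simp add: card_image)
    qed
    moreover have "R \<subseteq> {1..n}" using R by (simp add: P_def)
    ultimately show ?thesis
      using v_shift[of R R'] scale_power_Suc[OF l tensor_in_hom[OF x y]]
        scale_power_tensor[OF central l x y]
      by (simp add: h_def f_def g_def)
  qed
  interpret EA: comm_monoid "H ?E ?A" by (rule hom_comm_monoid[OF obE obA])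
  have hc: "h \<in> S \<rightarrow> carrier (H ?E ?A)" for S
    using h in_carrier_iff[OF obE obA] by auto
  let ?Q = "\<lambda>R. (\<lambda>R'. R \<union> (+) n ` R') ` P m"
  \<comment> \<open>The second block is recovered from the union as the set of i in {1..m} with n +
    i in it.\<close>
  have inj: "inj_on (\<lambda>R'. R \<union> (+) n ` R') (P m)" if "R \<in> P n" for R
  proof (rule inj_onI)
    fix S S' assume S: "S \<in> P m" "S' \<in> P m" "R \<union> (+) n ` S = R \<union> (+) n ` S'"
    have ge: "n + i \<notin> R" if "i \<in> {1..m}" for i
      using that \<open>R \<in> P n\<close> by (auto simp: P_def)
    have "T = {i \<in> {1..m}. n + i \<in> R \<union> (+) n ` T}" if "T \<in> P m" for T
      using that ge by (auto simp: P_def)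
    from this[OF S(1)] this[OF S(2)] show "S = S'" unfolding S(3) by (rule trans[OF _ sym])
  qed
  \<comment> \<open>The first block is recovered by intersecting the union with {1..n}.\<close>
  have disj: "R = R'" if R: "R \<in> P n" "R' \<in> P n" "?Q R \<inter> ?Q R' \<noteq> {}" for R R'
  proof -
    obtain S S' where S: "S \<in> P m" "S' \<in> P m" "R \<union> (+) n ` S = R' \<union> (+) n ` S'"
      using R(3) by blast
    have "T = (T \<union> (+) n ` U) \<inter> {1..n}" if "T \<in> P n" "U \<in> P m" for T U
      using that by (force simp: P_def)
    then show ?thesis using S R(1,2) by metis
  qed
  \<comment> \<open>A double sum over pairs of blocks: the inner sum collects the second source, the
    outer one the first, and the common scalar is pulled out of each by additivity.\<close>
  have sum3: "sum_arr H ?E ?A h (\<Union>R\<in>P n. ?Q R) = scale V l ?E ?A (s1 \<odot> s2)"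
  proof -
    have "sum_arr H ?E ?A h (\<Union>R\<in>P n. ?Q R)
        = sum_arr H ?E ?A (\<lambda>R. sum_arr H ?E ?A h (?Q R)) (P n)"
    proof (rule EA.finprod_UN_disjoint)
      show "pairwise (\<lambda>R R'. disjnt (?Q R) (?Q R')) (P n)"
        unfolding pairwise_def disjnt_def using disj by blast
    qed (use fin h in_carrier_iff[OF obE obA] in auto)
    also have "\<dots> = sum_arr H ?E ?A (\<lambda>R. scale V l ?E ?A (f R \<odot> s2)) (P n)"
    proof (rule sum_cong[OF obE obA])
      fix R assume R: "R \<in> P n"
      have "sum_arr H ?E ?A h (?Q R) = sum_arr H ?E ?A (\<lambda>R'. h (R \<union> (+) n ` R')) (P m)"
        by (rule EA.finprod_reindex[OF hc inj[OF R]])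
      also have "\<dots> = sum_arr H ?E ?A (\<lambda>R'. scale V l ?E ?A (f R \<odot> g R')) (P m)"
        by (rule sum_cong[OF obE obA h3[OF R]]) (use l f g in blast)+
      also have "\<dots> = scale V l ?E ?A (sum_arr H ?E ?A (\<lambda>R'. f R \<odot> g R') (P m))"
        by (rule additive_sum[OF obE obA obE obA scale_hom[OF l obE obA], symmetric]) (use f g in blast)
      also have "sum_arr H ?E ?A (\<lambda>R'. f R \<odot> g R') (P m) = f R \<odot> s2"
        unfolding s2_def
        by (rule additive_sum[OF ob(3,4) obE obA tensor_hom_right[OF ob(3,4) f], symmetric]) (rule g)
      finally show "sum_arr H ?E ?A h (?Q R) = scale V l ?E ?A (f R \<odot> s2)" .
    qed (use l f s in blast)
    also have "\<dots> = scale V l ?E ?A (sum_arr H ?E ?A (\<lambda>R. f R \<odot> s2) (P n))"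
      by (rule additive_sum[OF obE obA obE obA scale_hom[OF l obE obA], symmetric]) (use f s in blast)
    also have "sum_arr H ?E ?A (\<lambda>R. f R \<odot> s2) (P n) = s1 \<odot> s2"
      unfolding s1_def
      by (rule additive_sum[OF ob(1,2) obE obA tensor_hom_left[OF ob(1,2) s(2)], symmetric]) (rule f)
    finally show ?thesis .
  qed
  have sum1: "sum_arr H ?E ?A h (P n) = s1 \<odot> t2"
  proof -
    have "sum_arr H ?E ?A h (P n) = sum_arr H ?E ?A (\<lambda>R. f R \<odot> t2) (P n)"
      by (rule sum_cong[OF obE obA h1]) (use f t in blast)+
    then show ?thesis
      unfolding s1_def
      using additive_sum[OF ob(1,2) obE obA tensor_hom_left[OF ob(1,2) t(2)], of "P n" f] f by simp
  qed
  have sum2: "sum_arr H ?E ?A h ((`) ((+) n) ` P m) = t1 \<odot> s2"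
  proof -
    have "inj_on ((`) ((+) n)) (P m)" by (auto simp: inj_on_def inj_image_eq_iff)
    then have "sum_arr H ?E ?A h ((`) ((+) n) ` P m) = sum_arr H ?E ?A (\<lambda>R. h ((+) n ` R)) (P m)"
      by (rule EA.finprod_reindex[OF hc])
    also have "\<dots> = sum_arr H ?E ?A (\<lambda>R. t1 \<odot> g R) (P m)"
      by (rule sum_cong[OF obE obA h2]) (use g t in blast)+
    finally show ?thesis
      unfolding s2_def
      using additive_sum[OF ob(3,4) obE obA tensor_hom_right[OF ob(3,4) t(1)], of "P m" g] g by simp
  qed
  have shift_ne: "R \<notin> P n" if "R' \<in> P m" "R = T \<union> (+) n ` R'" for R R' T
    using that by (force simp: P_def)
  have "P (n + m) = (\<Union>R\<in>P n. ?Q R) \<union> P n \<union> (`) ((+) n) ` P m"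
    unfolding P_def by (rule nonempty_subsets_add)
  moreover have "sum_arr H ?E ?A h ((\<Union>R\<in>P n. ?Q R) \<union> P n \<union> (`) ((+) n) ` P m)
      = add_arr H ?E ?A (sum_arr H ?E ?A h ((\<Union>R\<in>P n. ?Q R) \<union> P n))
          (sum_arr H ?E ?A h ((`) ((+) n) ` P m))"
  proof (rule EA.finprod_Un_disjoint)
    \<comment> \<open>Subsets meeting only the second block are told apart from the others by
      missing {1..n}.\<close>
    have "R \<inter> {1..n} \<noteq> {}" if "R \<in> (\<Union>R\<in>P n. ?Q R) \<union> P n" for R
      using that by (auto simp: P_def)
    moreover have "R \<inter> {1..n} = {}" if "R \<in> (`) ((+) n) ` P m" for R
      using that by (auto simp: P_def)
    ultimately show "((\<Union>R\<in>P n. ?Q R) \<union> P n) \<inter> (`) ((+) n) ` P m = {}" by blast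
  qed (use fin hc in auto)
  moreover have "sum_arr H ?E ?A h ((\<Union>R\<in>P n. ?Q R) \<union> P n)
      = add_arr H ?E ?A (sum_arr H ?E ?A h (\<Union>R\<in>P n. ?Q R)) (sum_arr H ?E ?A h (P n))"
    by (rule EA.finprod_Un_disjoint) (use fin hc shift_ne in auto)
  ultimately have "sum_arr H ?E ?A h (P (n + m)) = add_arr H ?E ?A
      (add_arr H ?E ?A (scale V l ?E ?A (s1 \<odot> s2)) (s1 \<odot> t2)) (t1 \<odot> s2)"
    using sum1 sum2 sum3 by simp
  then show ?thesis
    unfolding s1_def s2_def t1_def t2_def P_def f_def g_def h_def G'_def
      A1_def A2_def E1_def E2_def n_def m_def
    by (simp add: graph_tensor_def binary_tensor_def Let_def)
qed

text \<open>With no slots the source is an empty sum, hence zero. The value is the same for every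
  family, also for the \<open>undefined\<close> one in the definition of the unit graph.\<close>

lemma graph_tensor_Empty:
  "graph_tensor V H l Empty G
    = \<lparr>ver = Unit V, edg = Unit V, src = zero_arr H (Unit V) (Unit V), tgt = Ide V (Unit V)\<rparr>"
proof -
  have "{R. R \<noteq> {} \<and> R \<subseteq> {1..len Empty}} = {}" by auto
  then show ?thesis
    using comm_monoid.finprod_empty[OF hom_comm_monoid[OF unit_obj unit_obj]]
    by (simp add: graph_tensor_def Let_def)
qed

lemma binary_tensor_simps [simp]:
  "ver (binary_tensor V H l G K) = ver G \<boxtimes> ver K"
  "edg (binary_tensor V H l G K) = edg G \<boxtimes> edg K"
  "tgt (binary_tensor V H l G K) = tgt G \<odot> tgt K"
  by (simp_all add: binary_tensor_def Let_def)

lemma Gph_in_hom: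
  assumes "G \<in> Obj (Gph V)"
  shows "in_hom (src G) (edg G) (ver G)" "in_hom (tgt G) (edg G) (ver G)"
  using assms by (auto simp: Obj_Gph_iff in_hom_def)

lemma Gph_ObjI:
  "\<lbrakk>in_hom (src G) (edg G) (ver G); in_hom (tgt G) (edg G) (ver G)\<rbrakk> \<Longrightarrow> G \<in> Obj (Gph V)"
  by (simp add: Obj_Gph_iff in_hom_def)

lemma binary_tensor_closed:
  assumes l: "in_hom l (Unit V) (Unit V)" and G: "G \<in> Obj (Gph V)" and K: "K \<in> Obj (Gph V)"
  shows "binary_tensor V H l G K \<in> Obj (Gph V)"
  by (rule Gph_ObjI; simp add: binary_tensor_def Let_def)
    (use l Gph_in_hom[OF G] Gph_in_hom[OF K] in blast)+

lemma graph_tensor_closed: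
  assumes central: "central_scalar V l" and l: "in_hom l (Unit V) (Unit V)"
  shows "(\<And>i. i \<in> {1..len w} \<Longrightarrow> G i \<in> Obj (Gph V)) \<Longrightarrow> graph_tensor V H l w G \<in> Obj (Gph V)"
proof (induction w arbitrary: G)
  case Empty
  show ?case by (rule Gph_ObjI) (use unit_obj in \<open>auto simp: graph_tensor_Empty\<close>)
next
  case Slot
  then show ?case using graph_tensor_Slot[of G l] by simp
next
  case (Join u v)
  have "graph_tensor V H l u G \<in> Obj (Gph V)"
    "graph_tensor V H l v (\<lambda>i. G (len u + i)) \<in> Obj (Gph V)"
    by (rule Join.IH; use Join.prems in simp)+
  then show ?case
    using graph_tensor_Join[OF central l, of u v G] Join.prems binary_tensor_closed[OF l] by simp
qed

section \<open>Morphisms of graphs between tensor products\<close>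

lemma Gph_HomI:
  assumes "in_hom f (ver G) (ver K)" "in_hom p (edg G) (edg K)"
    "src K \<cdot> p = f \<cdot> src G" "tgt K \<cdot> p = f \<cdot> tgt G"
  shows "(f, p) \<in> Hom (Gph V) G K"
  using assms by (simp add: Gph_def in_hom_def)

lemma Gph_HomE:
  assumes "fp \<in> Hom (Gph V) G K" "G \<in> Obj (Gph V)" "K \<in> Obj (Gph V)"
  obtains f p where "fp = (f, p)" "in_hom f (ver G) (ver K)" "in_hom p (edg G) (edg K)"
    "src K \<cdot> p = f \<cdot> src G" "tgt K \<cdot> p = f \<cdot> tgt G"
  using assms by (auto simp: Gph_def in_hom_def)

text \<open>The sources of two bracketings of the same family of graphs are sums over the same subsets
  \<open>R\<close>, so any morphism natural in the factors intertwines them summand by summand.\<close>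

lemma rebracketing_in_Gph:
  assumes l: "in_hom l (Unit V) (Unit V)"
    and G: "\<And>i. i \<in> {1..len w} \<Longrightarrow> G i \<in> Obj (Gph V)"
    and len: "len w' = len w"
    and a: "in_hom a (word_obj V w (\<lambda>i. ver (G i))) (word_obj V w' (\<lambda>i. ver (G i)))"
    and e: "in_hom e (word_obj V w (\<lambda>i. edg (G i))) (word_obj V w' (\<lambda>i. edg (G i)))"
    and nat: "\<And>R. a \<cdot> word_arr V w (chi G R) = word_arr V w' (chi G R) \<cdot> e"
  shows "(a, e) \<in> Hom (Gph V) (graph_tensor V H l w G) (graph_tensor V H l w' G)"
proof (rule Gph_HomI)
  let ?A = "word_obj V w (\<lambda>i. ver (G i))" and ?E = "word_obj V w (\<lambda>i. edg (G i))"
  let ?A' = "word_obj V w' (\<lambda>i. ver (G i))" and ?E' = "word_obj V w' (\<lambda>i. edg (G i))"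
  let ?P = "{R. R \<noteq> {} \<and> R \<subseteq> {1..len w}}" and ?k = "\<lambda>R. scalar_power V l (card (R :: nat set) - 1)"
  let ?x = "\<lambda>R. word_arr V w (chi G R)" and ?x' = "\<lambda>R. word_arr V w' (chi G R)"
  note pow = scalar_power_in_hom[OF l]
  note A = in_homD(1,2)[OF a] and E = in_homD(1,2)[OF e]
  have chi: "in_hom (chi G R i) (edg (G i)) (ver (G i))" if "i \<in> {1..len w}" for R i
    using Gph_in_hom[OF G[OF that]] by (simp add: chi_def)
  have x: "in_hom (?x R) ?E ?A" and x': "in_hom (?x' R) ?E' ?A'" for R
    by (rule word_arr_in_hom; use chi len in simp)+
  have "sum_arr H ?E' ?A' (\<lambda>R. scale V (?k R) ?E' ?A' (?x' R)) ?P \<cdot> e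
      = sum_arr H ?E ?A' (\<lambda>R. scale V (?k R) ?E' ?A' (?x' R) \<cdot> e) ?P"
    by (rule additive_sum[OF E(2) A(2) E(1) A(2) comp_hom_left[OF A(2) e]])
      (rule scale_in_hom[OF pow x'])
  also have "\<dots> = sum_arr H ?E ?A' (\<lambda>R. a \<cdot> scale V (?k R) ?E ?A (?x R)) ?P"
  proof (rule sum_cong[OF E(1) A(2)])
    fix R
    show "scale V (?k R) ?E' ?A' (?x' R) \<cdot> e = a \<cdot> scale V (?k R) ?E ?A (?x R)"
      using scale_comp[OF pow e x'] comp_scale[OF pow x a] nat by simp
    show "in_hom (a \<cdot> scale V (?k R) ?E ?A (?x R)) ?E ?A'"
      by (rule comp_in_hom[OF a scale_in_hom[OF pow x]])
  qed
  also have "\<dots> = a \<cdot> sum_arr H ?E ?A (\<lambda>R. scale V (?k R) ?E ?A (?x R)) ?P"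
    by (rule additive_sum[OF E(1) A(1) E(1) A(2) comp_hom_right[OF E(1) a], symmetric])
      (rule scale_in_hom[OF pow x])
  finally show "src (graph_tensor V H l w' G) \<cdot> e = a \<cdot> src (graph_tensor V H l w G)"
    by (simp add: graph_tensor_def Let_def len)
  \<comment> \<open>The naturality assumption covers R = {} as well, and that instance is the
    compatibility with targets.\<close>
  have "word_arr V v (\<lambda>i. tgt (G i)) = word_arr V v (chi G {})" for v
    by (rule word_arr_cong) (simp add: chi_def)
  then show "tgt (graph_tensor V H l w' G) \<cdot> e = a \<cdot> tgt (graph_tensor V H l w G)"
    using nat by (simp add: graph_tensor_def Let_def)
qed (use a e in \<open>simp_all add: graph_tensor_def Let_def\<close>)

text \<open>Both bracketings of three factors are read as closed formulas over words of length 3.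
  Each summand then needs only naturality of the associator at three morphisms, each a source or a
  target.\<close>

lemma assoc_in_Gph:
  assumes central: "central_scalar V l" and l: "in_hom l (Unit V) (Unit V)"
    and ob: "G \<in> Obj (Gph V)" "K \<in> Obj (Gph V)" "L \<in> Obj (Gph V)"
  shows "(Assoc V (ver G) (ver K) (ver L), Assoc V (edg G) (edg K) (edg L)) \<in> Hom (Gph V)
    (binary_tensor V H l (binary_tensor V H l G K) L)
    (binary_tensor V H l G (binary_tensor V H l K L))"
proof -
  \<comment> \<open>The third graph also serves as the value at every index other than 1 and 2, so
    that all values of the family are graphs.\<close>
  define F where "F i = (if i = 1 then G else if i = 2 then K else L)" for i :: nat
  have F: "F i \<in> Obj (Gph V)" for i using ob by (simp add: F_def)
  have F': "F (Suc 0) = G" "F 2 = K" "F (Suc (Suc 0)) = K" "F 3 = L" "F (Suc (Suc (Suc 0))) = L"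
    by (simp_all add: F_def)
  have V: "ver G \<in> Obj V" "ver K \<in> Obj V" "ver L \<in> Obj V"
    "edg G \<in> Obj V" "edg K \<in> Obj V" "edg L \<in> Obj V"
    using ob by (simp_all add: Obj_Gph_iff)
  let ?w = "Join (Join Slot Slot) Slot" and ?w' = "Join Slot (Join Slot Slot)"
  have "(Assoc V (ver G) (ver K) (ver L), Assoc V (edg G) (edg K) (edg L)) \<in> Hom (Gph V)
    (graph_tensor V H l ?w F) (graph_tensor V H l ?w' F)"
  proof (rule rebracketing_in_Gph[OF l F])
    fix R
    have "chi F R i \<in> Hom V (edg (F i)) (ver (F i))" for i
      using Gph_in_hom[OF F, of i] by (simp add: chi_def in_hom_def)
    from this[of 1] this[of 2] this[of 3]
    show "Assoc V (ver G) (ver K) (ver L) \<cdot> word_arr V ?w (chi F R)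
      = word_arr V ?w' (chi F R) \<cdot> Assoc V (edg G) (edg K) (edg L)"
      using V by (simp add: F' assoc_natural eval_nat_numeral)
  qed (use V assoc_in_hom in \<open>simp_all add: F'\<close>)
  moreover have "graph_tensor V H l Slot F = G"
    "graph_tensor V H l Slot (\<lambda>i. F (Suc i)) = K"
    "graph_tensor V H l Slot (\<lambda>i. F (Suc (Suc i))) = L"
    using graph_tensor_Slot[of F l] graph_tensor_Slot[of "\<lambda>i. F (Suc i)" l]
      graph_tensor_Slot[of "\<lambda>i. F (Suc (Suc i))" l] ob by (simp_all add: F')
  ultimately show ?thesis
    by (simp add: graph_tensor_Join[OF central l] F)
qed

text \<open>\<open>Join Empty Slot\<close> and \<open>Slot\<close> both have length 1, so removing a
  unit is a rebracketing of the constant family.\<close>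

lemma lunit_in_Gph:
  assumes central: "central_scalar V l" and l: "in_hom l (Unit V) (Unit V)"
    and G: "G \<in> Obj (Gph V)"
  shows "(LUnit V (ver G), LUnit V (edg G))
    \<in> Hom (Gph V) (binary_tensor V H l (graph_tensor V H l Empty F) G) G"
proof -
  have V: "ver G \<in> Obj V" "edg G \<in> Obj V" using G by (simp_all add: Obj_Gph_iff)
  have "(LUnit V (ver G), LUnit V (edg G)) \<in> Hom (Gph V)
    (graph_tensor V H l (Join Empty Slot) (\<lambda>i. G)) (graph_tensor V H l Slot (\<lambda>i. G))"
  proof (rule rebracketing_in_Gph[OF l G])
    fix R
    have "chi (\<lambda>i. G) R 1 \<in> Hom V (edg G) (ver G)"
      using Gph_in_hom[OF G] by (simp add: chi_def in_hom_def)
    then show "LUnit V (ver G) \<cdot> word_arr V (Join Empty Slot) (chi (\<lambda>i. G) R)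
      = word_arr V Slot (chi (\<lambda>i. G) R) \<cdot> LUnit V (edg G)"
      using V lunit_natural by simp
  qed (use V lunit_in_hom in simp_all)
  then show ?thesis
    by (simp add: graph_tensor_Join[OF central l] graph_tensor_Slot graph_tensor_Empty G)
qed

lemma runit_in_Gph:
  assumes central: "central_scalar V l" and l: "in_hom l (Unit V) (Unit V)"
    and G: "G \<in> Obj (Gph V)"
  shows "(RUnit V (ver G), RUnit V (edg G))
    \<in> Hom (Gph V) (binary_tensor V H l G (graph_tensor V H l Empty F)) G"
proof -
  have V: "ver G \<in> Obj V" "edg G \<in> Obj V" using G by (simp_all add: Obj_Gph_iff)
  have "(RUnit V (ver G), RUnit V (edg G)) \<in> Hom (Gph V)
    (graph_tensor V H l (Join Slot Empty) (\<lambda>i. G)) (graph_tensor V H l Slot (\<lambda>i. G))"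
  proof (rule rebracketing_in_Gph[OF l G])
    fix R
    have "chi (\<lambda>i. G) R 1 \<in> Hom V (edg G) (ver G)"
      using Gph_in_hom[OF G] by (simp add: chi_def in_hom_def)
    then show "RUnit V (ver G) \<cdot> word_arr V (Join Slot Empty) (chi (\<lambda>i. G) R)
      = word_arr V Slot (chi (\<lambda>i. G) R) \<cdot> RUnit V (edg G)"
      using V runit_natural by simp
  qed (use V runit_in_hom in simp_all)
  then show ?thesis
    by (simp add: graph_tensor_Join[OF central l] graph_tensor_Slot graph_tensor_Empty G)
qed

lemma tensor_in_Gph:
  assumes l: "in_hom l (Unit V) (Unit V)"
    and ob: "G \<in> Obj (Gph V)" "G' \<in> Obj (Gph V)" "K \<in> Obj (Gph V)" "K' \<in> Obj (Gph V)"
    and fp: "(f, p) \<in> Hom (Gph V) G G'" and gq: "(g, q) \<in> Hom (Gph V) K K'"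
  shows "(f \<odot> g, p \<odot> q) \<in> Hom (Gph V) (binary_tensor V H l G K) (binary_tensor V H l G' K')"
proof (rule Gph_HomI)
  have f: "in_hom f (ver G) (ver G')" "in_hom p (edg G) (edg G')"
    and f_eq: "src G' \<cdot> p = f \<cdot> src G" "tgt G' \<cdot> p = f \<cdot> tgt G"
    using Gph_HomE[OF fp ob(1,2)] by auto
  have g: "in_hom g (ver K) (ver K')" "in_hom q (edg K) (edg K')"
    and g_eq: "src K' \<cdot> q = g \<cdot> src K" "tgt K' \<cdot> q = g \<cdot> tgt K"
    using Gph_HomE[OF gq ob(3,4)] by auto
  note G = Gph_in_hom[OF ob(1)] and G' = Gph_in_hom[OF ob(2)]
    and K = Gph_in_hom[OF ob(3)] and K' = Gph_in_hom[OF ob(4)]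
  show fg: "in_hom (f \<odot> g) (ver (binary_tensor V H l G K)) (ver (binary_tensor V H l G' K'))"
    and pq: "in_hom (p \<odot> q) (edg (binary_tensor V H l G K)) (edg (binary_tensor V H l G' K'))"
    using f g by auto
  note fg' = fg[simplified] and pq' = pq[simplified]
  \<comment> \<open>One square serves four times: for the three summands of the source and for the
    target.\<close>
  have nat: "x' \<odot> y' \<cdot> p \<odot> q = f \<odot> g \<cdot> x \<odot> y"
    if "in_hom x (edg G) (ver G)" "in_hom y (edg K) (ver K)" "in_hom x' (edg G') (ver G')"
      "in_hom y' (edg K') (ver K')" "x' \<cdot> p = f \<cdot> x" "y' \<cdot> q = g \<cdot> y" for x y x' y'
    using interchange[OF f(2) that(3) g(2) that(4)] interchange[OF that(1) f(1) that(2) g(1)] that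
    by simp
  have ss: "in_hom (src G \<odot> src K) (edg G \<boxtimes> edg K) (ver G \<boxtimes> ver K)"
    "in_hom (src G' \<odot> src K') (edg G' \<boxtimes> edg K') (ver G' \<boxtimes> ver K')"
    using G(1) K(1) G'(1) K'(1) by blast+
  have st: "in_hom (src G \<odot> tgt K) (edg G \<boxtimes> edg K) (ver G \<boxtimes> ver K)"
    "in_hom (src G' \<odot> tgt K') (edg G' \<boxtimes> edg K') (ver G' \<boxtimes> ver K')"
    using G(1) K(2) G'(1) K'(2) by blast+
  have ts: "in_hom (tgt G \<odot> src K) (edg G \<boxtimes> edg K) (ver G \<boxtimes> ver K)"
    "in_hom (tgt G' \<odot> src K') (edg G' \<boxtimes> edg K') (ver G' \<boxtimes> ver K')"
    using G(2) K(1) G'(2) K'(1) by blast+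
  note sc = scale_in_hom[OF l ss(1)] scale_in_hom[OF l ss(2)]
  note nats = nat[OF G(1) K(1) G'(1) K'(1) f_eq(1) g_eq(1)]
    nat[OF G(1) K(2) G'(1) K'(2) f_eq(1) g_eq(2)] nat[OF G(2) K(1) G'(2) K'(1) f_eq(2) g_eq(1)]
  show "src (binary_tensor V H l G' K') \<cdot> p \<odot> q = f \<odot> g \<cdot> src (binary_tensor V H l G K)"
    using add_comp[OF pq' add_in_hom[OF sc(2) st(2)] ts(2)] add_comp[OF pq' sc(2) st(2)]
      comp_add[OF fg' add_in_hom[OF sc(1) st(1)] ts(1)] comp_add[OF fg' sc(1) st(1)]
      scale_comp[OF l pq' ss(2)] comp_scale[OF l ss(1) fg'] nats
    by (simp add: binary_tensor_def Let_def)
  show "tgt (binary_tensor V H l G' K') \<cdot> p \<odot> q = f \<odot> g \<cdot> tgt (binary_tensor V H l G K)"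
    using nat[OF G(2) K(2) G'(2) K'(2) f_eq(2) g_eq(2)] by simp
qed

section \<open>The monoidal data in components\<close>

lemma Gph_monoidal_simps [simp]:
  "Obj (Gph_monoidal V H l) = Obj (Gph V)"
  "Hom (Gph_monoidal V H l) = Hom (Gph V)"
  "(g, q) \<cdot>\<^bsub>Gph_monoidal V H l\<^esub> (f, p) = (g \<cdot> f, q \<cdot> p)"
  "Ide (Gph_monoidal V H l) G = (Ide V (ver G), Ide V (edg G))"
  "(f, p) \<odot>\<^bsub>Gph_monoidal V H l\<^esub> (g, q) = (f \<odot> g, p \<odot> q)"
  "Unit (Gph_monoidal V H l) = graph_tensor V H l Empty (\<lambda>i. undefined)"
  "Assoc (Gph_monoidal V H l) G K L
    = (Assoc V (ver G) (ver K) (ver L), Assoc V (edg G) (edg K) (edg L))"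
  "LUnit (Gph_monoidal V H l) G = (LUnit V (ver G), LUnit V (edg G))"
  "RUnit (Gph_monoidal V H l) G = (RUnit V (ver G), RUnit V (edg G))"
  by (simp_all add: Gph_monoidal_def Gph_def category_data.extend_def monoidal_data.fields_def)

text \<open>Kept apart from the simplification rules above because it is conditional: the one-slot
  products collapse to \<open>G\<close> and \<open>K\<close> when these are graphs.\<close>

lemma Gph_monoidal_tensor:
  assumes "central_scalar V l" "in_hom l (Unit V) (Unit V)"
    and "G \<in> Obj (Gph V)" "K \<in> Obj (Gph V)"
  shows "G \<boxtimes>\<^bsub>Gph_monoidal V H l\<^esub> K = binary_tensor V H l G K"
  using assms
  by (simp add: Gph_monoidal_def category_data.extend_def monoidal_data.fields_def
      graph_tensor_Join graph_tensor_Slot)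

end

section \<open>The monoidal category of graphs\<close>

lemma product_category_category:
  assumes "category C" "category D"
  shows "category (product_category C D)"
proof -
  interpret C: category C by fact
  interpret D: category D by fact
  show ?thesis
    by unfold_locales
      (auto simp: product_category_def C.ide_closed D.ide_closed C.ide_left D.ide_left
        C.ide_right D.ide_right intro: C.comp_closed D.comp_closed C.comp_assoc D.comp_assoc)
qed

lemma (in category) Gph_category: "category (Gph C)"
  by unfold_locales
    (auto simp: Gph_def ide_closed ide_left ide_right comp_closed comp_assoc[symmetric],
      (metis comp_assoc)+)

context monoidal_additive_category
begin

text \<open>The two records have different types, but \<open>category\<close> reads only the four
  fields that they share.\<close>

lemma Gph_monoidal_category: "category (Gph_monoidal V H l)"
proof -
  have eqs: "Obj (Gph_monoidal V H l) = Obj (Gph V)" "Hom (Gph_monoidal V H l) = Hom (Gph V)"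
    "Comp (Gph_monoidal V H l) = Comp (Gph V)" "Ide (Gph_monoidal V H l) = Ide (Gph V)"
    by (simp_all add: Gph_monoidal_def Gph_def category_data.extend_def)
  show ?thesis using Gph_category unfolding category_def eqs .
qed

text \<open>Componentwise inverses of a graph morphism again form a graph morphism, so invertibility
  can be checked in V.\<close>

lemma Gph_isomorphism:
  assumes ob: "G \<in> Obj (Gph V)" "K \<in> Obj (Gph V)"
    and fp: "(f, p) \<in> Hom (Gph V) G K"
    and iso: "isomorphism V (ver G) (ver K) f" "isomorphism V (edg G) (edg K) p"
  shows "isomorphism (Gph_monoidal V H l) G K (f, p)"
proof -
  have fp': "in_hom f (ver G) (ver K)" "in_hom p (edg G) (edg K)"
    and eq: "src K \<cdot> p = f \<cdot> src G" "tgt K \<cdot> p = f \<cdot> tgt G"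
    using Gph_HomE[OF fp ob] by auto
  obtain f' p' where inv: "in_hom f' (ver K) (ver G)" "f' \<cdot> f = Ide V (ver G)" "f \<cdot> f' = Ide V (ver K)"
      "in_hom p' (edg K) (edg G)" "p' \<cdot> p = Ide V (edg G)" "p \<cdot> p' = Ide V (edg K)"
    using iso ob unfolding isomorphism_def in_hom_def Obj_Gph_iff by blast
  \<comment> \<open>The square for the inverses is obtained from the given one by precomposing with
    \<open>p\<close>, which can be cancelled.\<close>
  have swap: "x \<cdot> p' = f' \<cdot> y"
    if x: "in_hom x (edg G) (ver G)" and y: "in_hom y (edg K) (ver K)" and xy: "y \<cdot> p = f \<cdot> x" for x y
  proof (rule isomorphism_epi[OF iso(2) fp'(2)])
    have "(x \<cdot> p') \<cdot> p = (f' \<cdot> f) \<cdot> x"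
      using in_hom_assoc[OF fp'(2) inv(4) x] inv comp_ide_left[OF x] comp_ide_right[OF x] by simp
    also have "\<dots> = (f' \<cdot> y) \<cdot> p"
      using in_hom_assoc[OF x fp'(1) inv(1)] in_hom_assoc[OF fp'(2) y inv(1)] xy by simp
    finally show "(x \<cdot> p') \<cdot> p = (f' \<cdot> y) \<cdot> p" .
  qed (use x y inv in blast)+
  have "(f', p') \<in> Hom (Gph V) K G"
    by (rule Gph_HomI[OF inv(1,4)])
      (use swap Gph_in_hom[OF ob(1)] Gph_in_hom[OF ob(2)] eq in blast)+
  then show ?thesis
    unfolding isomorphism_def using fp inv by force
qed

lemma Gph_monoidal_tensor_functor:
  assumes central: "central_scalar V l" and l: "in_hom l (Unit V) (Unit V)"
  defines "M \<equiv> Gph_monoidal V H l"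
  shows "category_functor (product_category M M) M
    (\<lambda>(X, Y). X \<boxtimes>\<^bsub>M\<^esub> Y) (\<lambda>(f, g). f \<odot>\<^bsub>M\<^esub> g)"
proof (intro category_functor.intro category_functor_axioms.intro)
  show "category M" "category (product_category M M)"
    unfolding M_def by (intro product_category_category Gph_monoidal_category)+
next
  fix X assume "X \<in> Obj (product_category M M)"
  then obtain G K where X: "X = (G, K)" "G \<in> Obj (Gph V)" "K \<in> Obj (Gph V)"
    by (auto simp: product_category_def M_def)
  then show "(case X of (X, Y) \<Rightarrow> X \<boxtimes>\<^bsub>M\<^esub> Y) \<in> Obj M"
    using binary_tensor_closed[OF l] Gph_monoidal_tensor[OF central l] by (simp add: M_def)
  show "(case Ide (product_category M M) X of (f, g) \<Rightarrow> f \<odot>\<^bsub>M\<^esub> g)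
      = Ide M (case X of (X, Y) \<Rightarrow> X \<boxtimes>\<^bsub>M\<^esub> Y)"
    using X Gph_monoidal_tensor[OF central l X(2,3)] tensor_ide
    by (simp add: product_category_def M_def Obj_Gph_iff)
next
  fix X Y f
  assume "X \<in> Obj (product_category M M)" "Y \<in> Obj (product_category M M)"
    "f \<in> Hom (product_category M M) X Y"
  then obtain G K G' K' f1 f2 g1 g2 where
    XY: "X = (G, K)" "Y = (G', K')" "f = ((f1, f2), (g1, g2))"
      "G \<in> Obj (Gph V)" "K \<in> Obj (Gph V)" "G' \<in> Obj (Gph V)" "K' \<in> Obj (Gph V)"
      "(f1, f2) \<in> Hom (Gph V) G G'" "(g1, g2) \<in> Hom (Gph V) K K'"
    by (auto simp: product_category_def M_def)
  then show "(case f of (f, g) \<Rightarrow> f \<odot>\<^bsub>M\<^esub> g)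
      \<in> Hom M (case X of (X, Y) \<Rightarrow> X \<boxtimes>\<^bsub>M\<^esub> Y) (case Y of (X, Y) \<Rightarrow> X \<boxtimes>\<^bsub>M\<^esub> Y)"
    using tensor_in_Gph[OF l XY(4,6,5,7,8,9)] Gph_monoidal_tensor[OF central l]
    by (simp add: M_def)
next
  fix X Y Z f g
  assume "X \<in> Obj (product_category M M)" "Y \<in> Obj (product_category M M)"
    "Z \<in> Obj (product_category M M)"
    "f \<in> Hom (product_category M M) X Y" "g \<in> Hom (product_category M M) Y Z"
  then obtain f1 f2 f3 f4 g1 g2 g3 g4 where
    eqs: "f = ((f1, f2), (f3, f4))" "g = ((g1, g2), (g3, g4))" and
    homs: "in_hom f1 (ver (fst X)) (ver (fst Y))" "in_hom g1 (ver (fst Y)) (ver (fst Z))"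
      "in_hom f2 (edg (fst X)) (edg (fst Y))" "in_hom g2 (edg (fst Y)) (edg (fst Z))"
      "in_hom f3 (ver (snd X)) (ver (snd Y))" "in_hom g3 (ver (snd Y)) (ver (snd Z))"
      "in_hom f4 (edg (snd X)) (edg (snd Y))" "in_hom g4 (edg (snd Y)) (edg (snd Z))"
    by (auto simp: product_category_def M_def Gph_def in_hom_def)
  show "(case g \<cdot>\<^bsub>product_category M M\<^esub> f of (f, g) \<Rightarrow> f \<odot>\<^bsub>M\<^esub> g)
      = (case g of (f, g) \<Rightarrow> f \<odot>\<^bsub>M\<^esub> g) \<cdot>\<^bsub>M\<^esub> (case f of (f, g) \<Rightarrow> f \<odot>\<^bsub>M\<^esub> g)"
    using interchange[OF homs(1,2,5,6)] interchange[OF homs(3,4,7,8)]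
    by (simp add: eqs product_category_def M_def)
qed

text \<open>Morphisms are pairs with componentwise operations, so every equation reduces to two
  equations in V. Sources and targets matter where an object or a morphism must lie in
  \<open>Gph V\<close>.\<close>

lemma Gph_monoidal_is_monoidal:
  assumes central: "central_scalar V l" and l: "in_hom l (Unit V) (Unit V)"
  shows "monoidal_category (Gph_monoidal V H l)"
proof (intro monoidal_category.intro monoidal_category_axioms.intro Gph_monoidal_category
    Gph_monoidal_tensor_functor[OF assms])
  let ?U = "graph_tensor V H l Empty (\<lambda>i. undefined)"
  note tens = Gph_monoidal_tensor[OF central l] and closed = binary_tensor_closed[OF l]
  have U: "?U \<in> Obj (Gph V)" using graph_tensor_closed[OF central l, of Empty] by simp
  then show "Unit (Gph_monoidal V H l) \<in> Obj (Gph_monoidal V H l)" by simp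
  fix X Y Z
  assume "X \<in> Obj (Gph_monoidal V H l)"
  then have X: "X \<in> Obj (Gph V)" by simp
  then have VX: "ver X \<in> Obj V" "edg X \<in> Obj V" by (simp_all add: Obj_Gph_iff)
  show "isomorphism (Gph_monoidal V H l) (Unit (Gph_monoidal V H l) \<boxtimes>\<^bsub>Gph_monoidal V H l\<^esub> X) X
      (LUnit (Gph_monoidal V H l) X)"
    \<comment> \<open>Simplification replaces the unit by its explicit record inside the product, so
      the product rules are supplied in that unfolded form.\<close>
    using Gph_isomorphism[OF closed[OF U X] X lunit_in_Gph[OF central l X]] VX lunit_iso
    by (simp add: tens[OF U X, unfolded graph_tensor_Empty]
        tens[OF X U, unfolded graph_tensor_Empty] graph_tensor_Empty)
  show "isomorphism (Gph_monoidal V H l) (X \<boxtimes>\<^bsub>Gph_monoidal V H l\<^esub> Unit (Gph_monoidal V H l)) X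
      (RUnit (Gph_monoidal V H l) X)"
    using Gph_isomorphism[OF closed[OF X U] X runit_in_Gph[OF central l X]] VX runit_iso
    by (simp add: tens[OF U X, unfolded graph_tensor_Empty]
        tens[OF X U, unfolded graph_tensor_Empty] graph_tensor_Empty)
  assume "Y \<in> Obj (Gph_monoidal V H l)"
  then have Y: "Y \<in> Obj (Gph V)" by simp
  then have VY: "ver Y \<in> Obj V" "edg Y \<in> Obj V" by (simp_all add: Obj_Gph_iff)
  show "Ide (Gph_monoidal V H l) X \<odot>\<^bsub>Gph_monoidal V H l\<^esub> LUnit (Gph_monoidal V H l) Y
      \<cdot>\<^bsub>Gph_monoidal V H l\<^esub> Assoc (Gph_monoidal V H l) X (Unit (Gph_monoidal V H l)) Y
    = RUnit (Gph_monoidal V H l) X \<odot>\<^bsub>Gph_monoidal V H l\<^esub> Ide (Gph_monoidal V H l) Y"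
    using VX VY triangle by (simp add: graph_tensor_Empty)
  show "LUnit (Gph_monoidal V H l) Y \<cdot>\<^bsub>Gph_monoidal V H l\<^esub>
        Ide (Gph_monoidal V H l) (Unit (Gph_monoidal V H l)) \<odot>\<^bsub>Gph_monoidal V H l\<^esub> f
      = f \<cdot>\<^bsub>Gph_monoidal V H l\<^esub> LUnit (Gph_monoidal V H l) X"
    and "RUnit (Gph_monoidal V H l) Y \<cdot>\<^bsub>Gph_monoidal V H l\<^esub>
        f \<odot>\<^bsub>Gph_monoidal V H l\<^esub> Ide (Gph_monoidal V H l) (Unit (Gph_monoidal V H l))
      = f \<cdot>\<^bsub>Gph_monoidal V H l\<^esub> RUnit (Gph_monoidal V H l) X"
    if "f \<in> Hom (Gph_monoidal V H l) X Y" for f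
    using that VX VY lunit_natural runit_natural
    by (auto simp: graph_tensor_Empty elim!: Gph_HomE[OF _ X Y] dest!: in_homD(3))
  assume "Z \<in> Obj (Gph_monoidal V H l)"
  then have Z: "Z \<in> Obj (Gph V)" by simp
  then have VZ: "ver Z \<in> Obj V" "edg Z \<in> Obj V" by (simp_all add: Obj_Gph_iff)
  show "isomorphism (Gph_monoidal V H l)
      ((X \<boxtimes>\<^bsub>Gph_monoidal V H l\<^esub> Y) \<boxtimes>\<^bsub>Gph_monoidal V H l\<^esub> Z)
      (X \<boxtimes>\<^bsub>Gph_monoidal V H l\<^esub> Y \<boxtimes>\<^bsub>Gph_monoidal V H l\<^esub> Z) (Assoc (Gph_monoidal V H l) X Y Z)"
    using Gph_isomorphism[OF closed[OF closed[OF X Y] Z] closed[OF X closed[OF Y Z]]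
        assoc_in_Gph[OF central l X Y Z]] VX VY VZ assoc_iso
    by (simp add: tens closed X Y Z)
next
  fix X Y Z X' Y' Z' f g h
  assume ob: "X \<in> Obj (Gph_monoidal V H l)" "Y \<in> Obj (Gph_monoidal V H l)"
    "Z \<in> Obj (Gph_monoidal V H l)" "X' \<in> Obj (Gph_monoidal V H l)"
    "Y' \<in> Obj (Gph_monoidal V H l)" "Z' \<in> Obj (Gph_monoidal V H l)"
    and hom: "f \<in> Hom (Gph_monoidal V H l) X X'" "g \<in> Hom (Gph_monoidal V H l) Y Y'"
      "h \<in> Hom (Gph_monoidal V H l) Z Z'"
  obtain f1 f2 where f: "f = (f1, f2)" "f1 \<in> Hom V (ver X) (ver X')" "f2 \<in> Hom V (edg X) (edg X')"
    using hom(1) by (auto simp: Gph_def)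
  obtain g1 g2 where g: "g = (g1, g2)" "g1 \<in> Hom V (ver Y) (ver Y')" "g2 \<in> Hom V (edg Y) (edg Y')"
    using hom(2) by (auto simp: Gph_def)
  obtain h1 h2 where h: "h = (h1, h2)" "h1 \<in> Hom V (ver Z) (ver Z')" "h2 \<in> Hom V (edg Z) (edg Z')"
    using hom(3) by (auto simp: Gph_def)
  show "Assoc (Gph_monoidal V H l) X' Y' Z' \<cdot>\<^bsub>Gph_monoidal V H l\<^esub>
        (f \<odot>\<^bsub>Gph_monoidal V H l\<^esub> g) \<odot>\<^bsub>Gph_monoidal V H l\<^esub> h
      = f \<odot>\<^bsub>Gph_monoidal V H l\<^esub> g \<odot>\<^bsub>Gph_monoidal V H l\<^esub> h \<cdot>\<^bsub>Gph_monoidal V H l\<^esub>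
        Assoc (Gph_monoidal V H l) X Y Z"
    using f g h ob by (simp add: Obj_Gph_iff assoc_natural)
next
  fix W X Y Z
  assume "W \<in> Obj (Gph_monoidal V H l)" "X \<in> Obj (Gph_monoidal V H l)"
    "Y \<in> Obj (Gph_monoidal V H l)" "Z \<in> Obj (Gph_monoidal V H l)"
  then show "Ide (Gph_monoidal V H l) W \<odot>\<^bsub>Gph_monoidal V H l\<^esub> Assoc (Gph_monoidal V H l) X Y Z
      \<cdot>\<^bsub>Gph_monoidal V H l\<^esub> Assoc (Gph_monoidal V H l) W (X \<boxtimes>\<^bsub>Gph_monoidal V H l\<^esub> Y) Z
      \<cdot>\<^bsub>Gph_monoidal V H l\<^esub>
        Assoc (Gph_monoidal V H l) W X Y \<odot>\<^bsub>Gph_monoidal V H l\<^esub> Ide (Gph_monoidal V H l) Z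
    = Assoc (Gph_monoidal V H l) W X (Y \<boxtimes>\<^bsub>Gph_monoidal V H l\<^esub> Z)
      \<cdot>\<^bsub>Gph_monoidal V H l\<^esub> Assoc (Gph_monoidal V H l) (W \<boxtimes>\<^bsub>Gph_monoidal V H l\<^esub> X) Y Z"
    using Gph_monoidal_tensor[OF central l] pentagon by (simp add: Obj_Gph_iff)
qed

text \<open>This justifies calling the closed formula an n-fold tensor product: it is the iterated
  binary product for every bracketing, inserted units included. Closure of graphs under the formula
  is needed so that the binary rule applies to the subwords.\<close>

lemma word_obj_Gph_monoidal:
  assumes central: "central_scalar V l" and l: "in_hom l (Unit V) (Unit V)"
  shows "(\<And>i. i \<in> {1..len w} \<Longrightarrow> G i \<in> Obj (Gph V))
    \<Longrightarrow> word_obj (Gph_monoidal V H l) w G = graph_tensor V H l w G"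
proof (induction w arbitrary: G)
  case Empty
  show ?case by (simp add: graph_tensor_Empty)
next
  case Slot
  then show ?case using graph_tensor_Slot[of G l] by simp
next
  case (Join u v)
  have G: "G i \<in> Obj (Gph V)" if "i \<in> {1..len u}" for i
    using Join.prems that by simp
  have G': "G (len u + i) \<in> Obj (Gph V)" if "i \<in> {1..len v}" for i
    using Join.prems that by simp
  show ?case
    using Join.IH(1)[OF G] Join.IH(2)[OF G'] graph_tensor_Join[OF central l, of u v G]
      Gph_monoidal_tensor[OF central l graph_tensor_closed[OF central l G]
        graph_tensor_closed[OF central l G']] Join.prems
    by simp
qed

lemma Gph_monoidal_ver_edg:
  assumes central: "central_scalar V l" and l: "in_hom l (Unit V) (Unit V)"
  shows "strict_monoidal_functor (Gph_monoidal V H l) V ver fst"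
    and "strict_monoidal_functor (Gph_monoidal V H l) V edg snd"
proof -
  note M = Gph_monoidal_is_monoidal[OF assms]
  note defs = strict_monoidal_functor_def strict_monoidal_functor_axioms_def
    category_functor_def category_functor_axioms_def
  \<comment> \<open>The componentwise rules are stated for explicit pairs; splitting the arguments
    makes them available for arbitrary arrows.\<close>
  have fst_comp: "fst (g \<cdot>\<^bsub>Gph_monoidal V H l\<^esub> f) = fst g \<cdot> fst f"
    and snd_comp: "snd (g \<cdot>\<^bsub>Gph_monoidal V H l\<^esub> f) = snd g \<cdot> snd f"
    and fst_tensor: "fst (g \<odot>\<^bsub>Gph_monoidal V H l\<^esub> f) = fst g \<odot> fst f"
    and snd_tensor: "snd (g \<odot>\<^bsub>Gph_monoidal V H l\<^esub> f) = snd g \<odot> snd f" for f g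
    by (cases f; cases g; simp)+
  have "fst f \<in> Hom V (ver G) (ver K)" "snd f \<in> Hom V (edg G) (edg K)"
    if "f \<in> Hom (Gph V) G K" for f G K
    using that by (auto simp: Gph_def)
  note simps = this fst_comp snd_comp fst_tensor snd_tensor
  have V: "category V" "monoidal_category V" by unfold_locales
  show "strict_monoidal_functor (Gph_monoidal V H l) V ver fst"
    "strict_monoidal_functor (Gph_monoidal V H l) V edg snd"
    unfolding defs using V M Gph_monoidal_category
    by (simp_all add: simps Obj_Gph_iff graph_tensor_Empty Gph_monoidal_tensor[OF assms])
qed

end

theorem proposition3p1:
  fixes V :: "('o, 'm, 'z) monoidal_data_scheme"
    and H :: "'o \<Rightarrow> 'o \<Rightarrow> 'm monoid"
    and l :: 'm
  assumes "monoidal_additive_category V H"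
    and "l \<in> Hom V (Unit V) (Unit V)"
    and "central_scalar V l"
  shows "monoidal_category (Gph_monoidal V H l)
    \<and> (\<forall>w G. (\<forall>i \<in> {1..len w}. G i \<in> Obj (Gph V)) \<longrightarrow>
         word_obj (Gph_monoidal V H l) w G = graph_tensor V H l w G)
    \<and> (\<forall>G \<in> Obj (Gph V). \<forall>K \<in> Obj (Gph V).
         G \<boxtimes>\<^bsub>Gph_monoidal V H l\<^esub> K =
           (let E = edg G \<boxtimes>\<^bsub>V\<^esub> edg K; A = ver G \<boxtimes>\<^bsub>V\<^esub> ver K in
            \<lparr>ver = A, edg = E,
             src = add_arr H E A
                     (add_arr H E A (scale V l E A (src G \<odot>\<^bsub>V\<^esub> src K)) (src G \<odot>\<^bsub>V\<^esub> tgt K))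
                     (tgt G \<odot>\<^bsub>V\<^esub> src K),
             tgt = tgt G \<odot>\<^bsub>V\<^esub> tgt K\<rparr>))
    \<and> Unit (Gph_monoidal V H l) =
        \<lparr>ver = Unit V, edg = Unit V, src = zero_arr H (Unit V) (Unit V), tgt = Ide V (Unit V)\<rparr>
    \<and> strict_monoidal_functor (Gph_monoidal V H l) V ver fst
    \<and> strict_monoidal_functor (Gph_monoidal V H l) V edg snd"
proof -
  interpret monoidal_additive_category V H by fact
  have l: "in_hom l (Unit V) (Unit V)" using assms(2) unit_obj by (simp add: in_hom_def)
  note central = assms(3)
  show ?thesis
    using Gph_monoidal_is_monoidal[OF central l] word_obj_Gph_monoidal[OF central l]
      Gph_monoidal_tensor[OF central l] Gph_monoidal_ver_edg[OF central l]
    by (simp add: graph_tensor_Empty binary_tensor_def)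
qed

end
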